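(* Let $z:\mathbb{R}\times S^1\to D$ be a smooth solution of \[ \partial_\tau\Big(\frac{z_\tau}{(1-|z|^2)^2}\Big)-e^{-2\tau}\partial_\theta\Big(\frac{z_\theta}{(1-|z|^2)^2}\Big)=\frac{2z}{(1-|z|^2)^3}\big[|z_\tau|^2-e^{-2\tau}|z_\theta|^2\big]. \] Assume there is $0<\alpha<1$ and $\tau_0$ such that at $\tau=\tau_0$, \[ \tfrac12\sup_{\theta}|z_\tau+e^{-\tau}z_\theta|_D^2+\tfrac12\sup_\theta|z_\tau-e^{-\tau}z_\theta|_D^2\le(1-\alpha)^2 . \] Then there are $v\in C^0(S^1,\mathbb{R}^2)$ with $|v|\le 1-\alpha$, a constant $C$ and a $T$ such that for $\tau\ge T$, \[ \Big\|\frac1\tau\frac{z(\tau,\cdot)}{|z(\tau,\cdot)|}\rho(\tau,\cdot)-v\Big\|_{C^0(S^1,\mathbb{R}^2)}+\Big\|\frac{2z_\tau(\tau,\cdot)}{1-|z(\tau,\cdot)|^2}-v\Big\|_{C^0(S^1,\mathbb{R}^2)}+e^{-\tau}\Big\|\frac{2z_\theta(\tau,\cdot)}{1-|z(\tau,\cdot)|^2}\Big\|_{C^0(S^1,\mathbb{R}^2)}\le C\tau^{-1}. \]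
   Context: $D$ is the open unit disc in $\mathbb{C}\cong\mathbb{R}^2$ (the hyperbolic plane with metric $4(dx^2+dy^2)/(1-x^2-y^2)^2$); $S^1=\mathbb{R}/2\pi\mathbb{Z}$ with coordinate $\theta$. For a complex quantity $w$ built from derivatives of $z$ at a point, $|w|_D^2=\frac{4}{(1-|z|^2)^2}|w|^2$. $\rho=\ln\frac{1+|z|}{1-|z|}$ is the hyperbolic distance from $0$ to $z$; the function $\frac{z}{|z|}\rho$ is understood as the smooth function it extends to (equal to $0$ where $z=0$). $\|\cdot\|_{C^0}$ denotes the sup norm over $S^1$. *)

theory Defs
  imports "HOL-Analysis.Analysis"
begin

definition pt :: "(real \<times> real \<Rightarrow> complex) \<Rightarrow> real \<times> real \<Rightarrow> complex" where
  "pt f p = vector_derivative (\<lambda>s. f (s, snd p)) (at (fst p))"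

definition pth :: "(real \<times> real \<Rightarrow> complex) \<Rightarrow> real \<times> real \<Rightarrow> complex" where
  "pth f p = vector_derivative (\<lambda>s. f (fst p, s)) (at (snd p))"

coinductive smooth2 :: "(real \<times> real \<Rightarrow> complex) \<Rightarrow> bool" where
  "(\<forall>p. (f has_derivative (\<lambda>(a, b). a *\<^sub>R pt f p + b *\<^sub>R pth f p)) (at p))
   \<Longrightarrow> smooth2 (pt f) \<Longrightarrow> smooth2 (pth f) \<Longrightarrow> smooth2 f"

text \<open>Hyperbolic norm of a tangent vector w at z in the disc:
  |w|_D = 2|w|/(1-|z|^2).\<close>
definition normD :: "complex \<Rightarrow> complex \<Rightarrow> real" where
  "normD z w = 2 * norm w / (1 - (norm z)\<^sup>2)"

text \<open>The smooth function (z/|z|) rho, rho = ln((1+|z|)/(1-|z|)), equal to 0 at z = 0.\<close>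
definition hypvec :: "complex \<Rightarrow> complex" where
  "hypvec z = (if z = 0 then 0
     else (z / complex_of_real (norm z)) * complex_of_real (ln ((1 + norm z) / (1 - norm z))))"

end

theory Submission
  imports Defs
begin

text \<open>
  In the orthonormal frame \<open>(1 - |z|^2)/2 * \<partial>\<close> of the disc, write \<open>w\<close>, \<open>y\<close> for the components of
  \<open>z_t\<close>, \<open>z_\<theta>\<close>. The norms of \<open>u = w \<pm> e^-t y\<close> satisfy transport inequalities along the explicit
  characteristics \<open>\<theta> \<pm> e^-t\<close>; a maximum principle bounds the mean of the two squared suprema by
  its initial value, and the two suprema equalize like \<open>e^-t\<close>. Hence \<open>|u| \<le> \<kappa> < 1\<close> eventually. The same
  argument for \<open>y\<close> and its covariant derivatives, where the only new term is the curvature term of size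
  \<open>|w| |y| |u|\<close>, shows that they grow at most like \<open>e^(k t)\<close> with some \<open>k < 1\<close>. Therefore \<open>e^-t y\<close> and the
  covariant acceleration \<open>e^-2t D_\<theta> y\<close> of the curves \<open>t \<mapsto> z(t, \<theta>)\<close> decay exponentially.

  What remains is an ODE problem for a curve in the hyperbolic plane with exponentially small acceleration.
  Let \<open>M\<close> be its limiting speed. The logarithmic derivative \<open>r\<close> of the hyperbolic cosine of the distance to
  the origin satisfies \<open>r' = |w|^2 - r^2\<close> up to an exponentially small error, so \<open>r\<close> enters the stable region
  \<open>r > M/2\<close> at a time of order \<open>1/M\<close>, after which \<open>|w|^2 - r^2\<close>, which controls the rotation of \<open>w\<close>,
  is at most of order \<open>M^2 e^(-c M t)\<close>. Since \<open>M e^(-c M t)\<close> is bounded by \<open>1/(c t)\<close> and has an integral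
  bounded independently of \<open>M\<close>, both rates follow uniformly in \<open>\<theta>\<close>.
\<close>

section \<open>Partial derivatives\<close>

text \<open>Total differentiability with both partial derivatives named. This gives the chain rule
  along oblique curves, which the mere existence of partial derivatives would not.\<close>

definition has_partials :: "(real \<times> real \<Rightarrow> complex) \<Rightarrow> (real \<times> real \<Rightarrow> complex) \<Rightarrow> (real \<times> real \<Rightarrow> complex) \<Rightarrow> bool"
  where "has_partials g g1 g2 \<longleftrightarrow>
    (\<forall>p. (g has_derivative (\<lambda>(a, b). a *\<^sub>R g1 p + b *\<^sub>R g2 p)) (at p))"

lemma has_partials_eq_rhs:
  assumes "has_partials g g1 g2" "\<And>p. g1 p = h1 p" "\<And>p. g2 p = h2 p"
  shows "has_partials g h1 h2"
  using assms by (simp add: has_partials_def)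

lemma has_partials_const: "has_partials (\<lambda>p. c) (\<lambda>p. 0) (\<lambda>p. 0)"
  by (simp add: has_partials_def case_prod_unfold)

lemma has_partials_add:
  assumes "has_partials f f1 f2" "has_partials g g1 g2"
  shows "has_partials (\<lambda>p. f p + g p) (\<lambda>p. f1 p + g1 p) (\<lambda>p. f2 p + g2 p)"
  unfolding has_partials_def
proof
  fix p
  show "((\<lambda>p. f p + g p) has_derivative (\<lambda>(a, b). a *\<^sub>R (f1 p + g1 p) + b *\<^sub>R (f2 p + g2 p))) (at p)"
    using has_derivative_add[OF assms[unfolded has_partials_def, rule_format, of p]]
    by (rule has_derivative_eq_rhs) (auto simp: fun_eq_iff algebra_simps)
qed

lemma has_partials_mult:
  assumes "has_partials f f1 f2" "has_partials g g1 g2"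
  shows "has_partials (\<lambda>p. f p * g p) (\<lambda>p. f1 p * g p + f p * g1 p) (\<lambda>p. f2 p * g p + f p * g2 p)"
  unfolding has_partials_def
proof
  fix p
  show "((\<lambda>p. f p * g p) has_derivative
    (\<lambda>(a, b). a *\<^sub>R (f1 p * g p + f p * g1 p) + b *\<^sub>R (f2 p * g p + f p * g2 p))) (at p)"
    using has_derivative_mult[OF assms[unfolded has_partials_def, rule_format, of p]]
    by (rule has_derivative_eq_rhs) (auto simp: fun_eq_iff algebra_simps)
qed

lemma has_partials_cnj:
  assumes "has_partials f f1 f2"
  shows "has_partials (\<lambda>p. cnj (f p)) (\<lambda>p. cnj (f1 p)) (\<lambda>p. cnj (f2 p))"
  unfolding has_partials_def
proof
  fix p
  show "((\<lambda>p. cnj (f p)) has_derivative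
    (\<lambda>(a, b). a *\<^sub>R cnj (f1 p) + b *\<^sub>R cnj (f2 p))) (at p)"
    using has_derivative_cnj[OF assms[unfolded has_partials_def, rule_format, of p]]
    by (rule has_derivative_eq_rhs) (auto simp: fun_eq_iff algebra_simps)
qed

lemma has_partials_inverse:
  assumes "has_partials f f1 f2" "\<And>p. f p \<noteq> 0"
  shows "has_partials (\<lambda>p. inverse (f p)) (\<lambda>p. - (inverse (f p))\<^sup>2 * f1 p) (\<lambda>p. - (inverse (f p))\<^sup>2 * f2 p)"
  unfolding has_partials_def
proof
  fix p
  show "((\<lambda>p. inverse (f p)) has_derivative
    (\<lambda>(a, b). a *\<^sub>R (- (inverse (f p))\<^sup>2 * f1 p) + b *\<^sub>R (- (inverse (f p))\<^sup>2 * f2 p))) (at p)"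
    using Deriv.has_derivative_inverse[OF assms(2) assms(1)[unfolded has_partials_def, rule_format, of p]]
    by (rule has_derivative_eq_rhs) (auto simp: fun_eq_iff algebra_simps power2_eq_square)
qed

lemma has_partials_fst:
  assumes "\<And>t. (h has_vector_derivative h' t) (at t)"
  shows "has_partials (\<lambda>p. h (fst p)) (\<lambda>p. h' (fst p)) (\<lambda>p. 0)"
  unfolding has_partials_def
proof
  fix p :: "real \<times> real"
  have "(h has_derivative (\<lambda>x. x *\<^sub>R h' (fst p))) (at (fst p))"
    using assms by (simp add: has_vector_derivative_def)
  from has_derivative_compose[OF has_derivative_fst[OF has_derivative_ident] this]
  show "((\<lambda>p. h (fst p)) has_derivative (\<lambda>(a, b). a *\<^sub>R h' (fst p) + b *\<^sub>R 0)) (at p)"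
    by (simp add: case_prod_unfold)
qed

lemma has_partials_continuous:
  assumes "has_partials g g1 g2"
  shows "continuous_on S g"
proof (rule continuous_at_imp_continuous_on, rule ballI)
  fix p
  show "isCont g p"
    using assms[unfolded has_partials_def, rule_format, of p] by (rule has_derivative_continuous)
qed

lemma has_partials_curve:
  assumes "has_partials g g1 g2" "(c has_real_derivative c') (at t)"
  shows "((\<lambda>s. g (s, c s)) has_vector_derivative (g1 (t, c t) + of_real c' * g2 (t, c t))) (at t)"
proof -
  have "((\<lambda>s. (s, c s)) has_derivative (\<lambda>x. (x, x * c'))) (at t)"
    using assms(2) by (auto intro!: derivative_eq_intros simp: has_field_derivative_def mult.commute)
  from has_derivative_compose[OF this assms(1)[unfolded has_partials_def, rule_format]]
  show ?thesis
    unfolding has_vector_derivative_def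
    by (rule has_derivative_eq_rhs) (auto simp: fun_eq_iff scaleR_conv_of_real algebra_simps)
qed

lemma has_partials_1:
  assumes "has_partials g g1 g2"
  shows "((\<lambda>s. g (s, x)) has_vector_derivative g1 (t, x)) (at t)"
  using has_partials_curve[OF assms, of "\<lambda>_. x" 0 t] by simp

lemma has_partials_2:
  assumes "has_partials g g1 g2"
  shows "((\<lambda>s. g (t, s)) has_vector_derivative g2 (t, x)) (at x)"
proof -
  have "((\<lambda>s. (t, s)) has_derivative (\<lambda>h. (0, h))) (at x)"
    by (auto intro!: derivative_eq_intros)
  from has_derivative_compose[OF this assms(1)[unfolded has_partials_def, rule_format]]
  show ?thesis
    unfolding has_vector_derivative_def
    by (rule has_derivative_eq_rhs) (auto simp: fun_eq_iff)
qed

lemma has_partials_unique: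
  assumes "has_partials g g1 g2" "has_partials g h1 h2"
  shows "g1 p = h1 p" "g2 p = h2 p"
proof -
  obtain t x where p: "p = (t, x)" by fastforce
  show "g1 p = h1 p"
    using vector_derivative_unique_at[OF has_partials_1[OF assms(1), of x t] has_partials_1[OF assms(2), of x t]]
    by (simp add: p)
  show "g2 p = h2 p"
    using vector_derivative_unique_at[OF has_partials_2[OF assms(1), of t x] has_partials_2[OF assms(2), of t x]]
    by (simp add: p)
qed

text \<open>Writing \<open>g\<close> as a time integral of \<open>g1\<close> and differentiating
  under the integral sign exhibits \<open>g2\<close>, up to its value at the initial time, as a time
  integral of \<open>g12\<close>. Its time derivative is therefore both \<open>g12\<close> and
  \<open>g21\<close>.\<close>

lemma mixed_partials_eq:
  assumes g: "has_partials g g1 g2" and g1: "has_partials g1 g11 g12" and g2: "has_partials g2 g21 g22"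
    and c12: "continuous_on UNIV g12"
  shows "g12 p = g21 p"
proof -
  obtain t x where p: "p = (t, x)" by fastforce
  define a b where "a = t - 1" and "b = t + 1"
  have ab: "a < t" "t < b" by (auto simp: a_def b_def)
  have cont1: "continuous_on S (\<lambda>s. g1 (s, \<theta>))" for \<theta> S
    by (rule continuous_on_compose2[OF has_partials_continuous[OF g1, of UNIV]])
      (auto intro!: continuous_intros)
  have ftc: "((\<lambda>s. g1 (s, \<theta>)) has_integral (g (u, \<theta>) - g (a, \<theta>))) {a..u}" if "a \<le> u" for u \<theta>
    by (rule fundamental_theorem_of_calculus[OF that])
      (auto intro!: has_vector_derivative_at_within has_partials_1[OF g])
  have int12: "g2 (u, x) - g2 (a, x) = integral {a..u} (\<lambda>s. g12 (s, x))" if u: "a \<le> u" for u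
  proof -
    have "((\<lambda>\<theta>. integral (cbox a u) (\<lambda>s. g1 (s, \<theta>))) has_vector_derivative
        integral (cbox a u) (\<lambda>s. g12 (s, x))) (at x within UNIV)"
    proof (rule leibniz_rule_vector_derivative)
      show "((\<lambda>\<theta>. g1 (s, \<theta>)) has_vector_derivative g12 (s, \<theta>)) (at \<theta> within UNIV)" for \<theta> s
        by (rule has_partials_2[OF g1])
      show "(\<lambda>s. g1 (s, \<theta>)) integrable_on cbox a u" for \<theta>
        using ftc[OF u, of \<theta>] by (auto simp: integrable_on_def)
      show "continuous_on (UNIV \<times> cbox a u) (\<lambda>(\<theta>, s). g12 (s, \<theta>))"
        unfolding case_prod_unfold
        by (rule continuous_on_compose2[OF c12]) (auto intro!: continuous_intros)
    qed auto
    moreover have "integral (cbox a u) (\<lambda>s. g1 (s, \<theta>)) = g (u, \<theta>) - g (a, \<theta>)" for \<theta>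
      using integral_unique[OF ftc[OF u, of \<theta>]] by simp
    ultimately have "((\<lambda>\<theta>. g (u, \<theta>) - g (a, \<theta>)) has_vector_derivative
        integral {a..u} (\<lambda>s. g12 (s, x))) (at x)"
      by simp
    moreover have "((\<lambda>\<theta>. g (u, \<theta>) - g (a, \<theta>)) has_vector_derivative (g2 (u, x) - g2 (a, x))) (at x)"
      by (intro derivative_intros has_partials_2[OF g])
    ultimately show ?thesis
      by (rule vector_derivative_unique_at[symmetric])
  qed
  have "continuous_on {a..b} (\<lambda>s. g12 (s, x))"
    by (rule continuous_on_compose2[OF c12]) (auto intro!: continuous_intros)
  then have "((\<lambda>u. integral {a..u} (\<lambda>s. g12 (s, x))) has_vector_derivative g12 (t, x)) (at t within {a..b})"
    using ab by (intro integral_has_vector_derivative) auto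
  then have "((\<lambda>u. integral {a..u} (\<lambda>s. g12 (s, x))) has_vector_derivative g12 (t, x)) (at t)"
    using at_within_Icc_at[OF ab] by (simp only:)
  then have "((\<lambda>u. g2 (u, x) - g2 (a, x)) has_vector_derivative g12 (t, x)) (at t)"
    by (rule has_vector_derivative_transform_within_open[of _ _ _ "{a<..<b}"])
      (use ab int12 in auto)
  moreover have "((\<lambda>u. g2 (u, x) - g2 (a, x)) has_vector_derivative (g21 (t, x) - 0)) (at t)"
    by (intro derivative_intros has_partials_1[OF g2])
  ultimately have "g12 (t, x) = g21 (t, x) - 0"
    by (rule vector_derivative_unique_at)
  then show ?thesis
    by (simp add: p)
qed

lemma smooth2_partials:
  assumes "smooth2 f"
  shows "has_partials f (pt f) (pth f)" "smooth2 (pt f)" "smooth2 (pth f)"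
  using assms by (auto elim: smooth2.cases simp: has_partials_def)

lemma smooth2_mixed:
  assumes "smooth2 f"
  shows "pth (pt f) = pt (pth f)"
proof
  fix p
  note s = smooth2_partials
  show "pth (pt f) p = pt (pth f) p"
    by (rule mixed_partials_eq[OF s(1)[OF assms] s(1)[OF s(2)[OF assms]] s(1)[OF s(3)[OF assms]]])
      (rule has_partials_continuous[OF s(1)[OF s(3)[OF s(2)[OF assms]]]])
qed

lemma norm_squared_has_derivative:
  fixes f :: "real \<Rightarrow> complex"
  assumes "(f has_vector_derivative f') (at t)"
  shows "((\<lambda>r. (norm (f r))\<^sup>2) has_real_derivative 2 * Re (cnj (f t) * f')) (at t)"
proof -
  have "((\<lambda>r. f r \<bullet> f r) has_derivative (\<lambda>h. f t \<bullet> (h *\<^sub>R f') + (h *\<^sub>R f') \<bullet> f t)) (at t)"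
    using assms unfolding has_vector_derivative_def by (intro has_derivative_inner)
  then show ?thesis
    unfolding has_field_derivative_def power2_norm_eq_inner
    by (rule has_derivative_eq_rhs) (auto simp: fun_eq_iff inner_complex_def algebra_simps)
qed

section \<open>The moving frame and the transport equations\<close>

lemma norm_lt_one_nonzero:
  fixes z :: complex
  assumes "norm z < 1"
  shows "1 - z * cnj z \<noteq> 0"
proof
  assume "1 - z * cnj z = 0"
  then have "z * cnj z = 1" by simp
  then have "(norm z)\<^sup>2 = 1" by (metis complex_norm_square of_real_eq_1_iff of_real_power)
  then show False using assms using norm_ge_zero[of z] unfolding power2_eq_1_iff by linarith
qed

text \<open>Here \<open>zc\<close>, \<open>wc\<close>, \<open>yc\<close> stand for conjugates, the
  capital letters \<open>W\<close>, \<open>U\<close> for covariant second derivatives,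
  \<open>N\<close> for \<open>lam\<close> times a third derivative and \<open>h\<close> for 1/2.
  Treated as independent variables, they turn the commutator formula into a polynomial identity
  modulo \<open>2 * h = 1\<close>.\<close>

lemma commutator_identity_1:
  fixes z zc w wc y yc W U N h :: complex
  assumes "2 * h = 1"
  shows "(zc * w + z * wc) * h * (U - zc * w * y) + N
     + ((wc * (1 - zc * z) * h * w + zc * (W - (zc * w - z * wc) * h * w)) * y + zc * w * (U - (zc * w - z * wc) * h * y))
     + (zc * w - z * wc) * h * U
   = (zc * y + z * yc) * h * (W - zc * w * w) + N
     + ((yc * (1 - zc * z) * h * w + zc * (U - (zc * y - z * yc) * h * w)) * w + zc * w * (U - (zc * y - z * yc) * h * w))
     + (zc * y - z * yc) * h * W + (wc * y - w * yc) * h * w"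
  using assms by algebra

lemma commutator_identity_2:
  fixes z zc w wc y yc Y U N h :: complex
  assumes "2 * h = 1"
  shows "(zc * w + z * wc) * h * (Y - zc * y * y) + N
     + ((wc * (1 - zc * z) * h * y + zc * (U - (zc * w - z * wc) * h * y)) * y + zc * y * (U - (zc * w - z * wc) * h * y))
     + (zc * w - z * wc) * h * Y
   = (zc * y + z * yc) * h * (U - zc * w * y) + N
     + ((yc * (1 - zc * z) * h * w + zc * (U - (zc * y - z * yc) * h * w)) * y + zc * w * (Y - (zc * y - z * yc) * h * y))
     + (zc * y - z * yc) * h * U + (wc * y - w * yc) * h * y"
  using assms by algebra

locale disc_wave_map =
  fixes z :: "real \<times> real \<Rightarrow> complex"
  assumes smooth: "smooth2 z"
    and disc: "norm (z p) < 1"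
    and pde: "vector_derivative (\<lambda>s. pt z (s, \<theta>) / complex_of_real ((1 - (norm (z (s, \<theta>)))\<^sup>2)\<^sup>2)) (at t)
      - complex_of_real (exp (-2 * t)) *
        vector_derivative (\<lambda>s. pth z (t, s) / complex_of_real ((1 - (norm (z (t, s)))\<^sup>2)\<^sup>2)) (at \<theta>)
      = 2 * z (t, \<theta>) / complex_of_real ((1 - (norm (z (t, \<theta>)))\<^sup>2) ^ 3)
        * complex_of_real ((norm (pt z (t, \<theta>)))\<^sup>2 - exp (-2 * t) * (norm (pth z (t, \<theta>)))\<^sup>2)"
begin

text \<open>\<open>w\<close> and \<open>y\<close> are the components of the two derivatives of \<open>z\<close> in the orthonormal frame
  \<open>(1 - |z|^2)/2 * \<partial>\<close> of the hyperbolic disc; in that frame the Levi-Civita connection pulls back to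
  \<open>g \<mapsto> \<partial>g + i Im (cnj z * w) g\<close>, respectively \<open>g \<mapsto> \<partial>g + i Im (cnj z * y) g\<close>. \<open>W\<close>, \<open>U\<close>, \<open>Y\<close> are the
  covariant second derivatives of \<open>z\<close>. Real and imaginary parts are written with \<open>cnj\<close> to keep the
  computations polynomial.\<close>

definition "lam p = 2 * inverse (1 - z p * cnj (z p))"
definition "w p = lam p * pt z p"
definition "y p = lam p * pth z p"
definition "om1 p = (cnj (z p) * w p - z p * cnj (w p)) * (1/2)"
definition "om2 p = (cnj (z p) * y p - z p * cnj (y p)) * (1/2)"
definition "W p = lam p * pt (pt z) p + cnj (z p) * w p * w p"
definition "U p = lam p * pth (pt z) p + cnj (z p) * w p * y p"
definition "Y p = lam p * pth (pth z) p + cnj (z p) * y p * y p"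
definition "kap p = (cnj (w p) * y p - w p * cnj (y p)) * (1/2)"

lemma nz: "1 - z p * cnj (z p) \<noteq> 0"
  using disc norm_lt_one_nonzero by blast

lemma lam_nz: "lam p \<noteq> 0"
  using nz by (simp add: lam_def)

lemma cnj_lam: "cnj (lam p) = lam p"
  by (simp add: lam_def mult.commute)

lemma inv_lam: "lam p * (1 - z p * cnj (z p)) = 2"
  using nz[of p] by (simp add: lam_def)

lemma lam_of_real: "lam p = of_real (2 / (1 - (norm (z p))\<^sup>2))"
  by (simp add: lam_def complex_norm_square[symmetric] divide_inverse)

text \<open>Mixed derivatives are normalized to have \<open>pt\<close> innermost, so that equal
  derivatives are syntactically equal in the algebra below.\<close>

lemma hp_z: "has_partials z (pt z) (pth z)"
  and hp_z1: "has_partials (pt z) (pt (pt z)) (pth (pt z))"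
  and hp_z2: "has_partials (pth z) (pth (pt z)) (pth (pth z))"
  and hp_z11: "has_partials (pt (pt z)) (pt (pt (pt z))) (pth (pt (pt z)))"
  and hp_z12: "has_partials (pth (pt z)) (pth (pt (pt z))) (pth (pth (pt z)))"
  and hp_z22: "has_partials (pth (pth z)) (pth (pth (pt z))) (pth (pth (pth z)))"
proof -
  note s = smooth2_partials
  have m: "pth (pt z) = pt (pth z)" by (rule smooth2_mixed[OF smooth])
  have m1: "pth (pt (pt z)) = pt (pth (pt z))" by (rule smooth2_mixed[OF s(2)[OF smooth]])
  have m2: "pt (pth (pth z)) = pth (pth (pt z))"
    unfolding m by (rule smooth2_mixed[OF s(3)[OF smooth], symmetric])
  show "has_partials z (pt z) (pth z)" by (intro s smooth)
  show "has_partials (pt z) (pt (pt z)) (pth (pt z))" by (intro s smooth)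
  show "has_partials (pth z) (pth (pt z)) (pth (pth z))" unfolding m by (intro s smooth)
  show "has_partials (pt (pt z)) (pt (pt (pt z))) (pth (pt (pt z)))" by (intro s smooth)
  show "has_partials (pth (pt z)) (pth (pt (pt z))) (pth (pth (pt z)))"
    unfolding m1 by (intro s smooth)
  show "has_partials (pth (pth z)) (pth (pth (pt z))) (pth (pth (pth z)))"
    unfolding m2[symmetric] by (intro s smooth)
qed

lemma hp_lam: "has_partials lam
    (\<lambda>p. lam p * (cnj (z p) * w p + z p * cnj (w p)) * (1/2))
    (\<lambda>p. lam p * (cnj (z p) * y p + z p * cnj (y p)) * (1/2))"
proof -
  have "has_partials (\<lambda>p. 1 + (- 1) * (z p * cnj (z p)))
     (\<lambda>p. 0 + (0 * (z p * cnj (z p)) + (-1) * (pt z p * cnj (z p) + z p * cnj (pt z p))))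
     (\<lambda>p. 0 + (0 * (z p * cnj (z p)) + (-1) * (pth z p * cnj (z p) + z p * cnj (pth z p))))"
    by (intro has_partials_add has_partials_mult has_partials_const has_partials_cnj hp_z)
  from has_partials_mult[OF has_partials_const[of 2] has_partials_inverse[OF this]] nz
  have "has_partials (\<lambda>p. 2 * inverse (1 - z p * cnj (z p)))
     (\<lambda>p. 2 * (inverse (1 - z p * cnj (z p)))\<^sup>2 * (pt z p * cnj (z p) + z p * cnj (pt z p)))
     (\<lambda>p. 2 * (inverse (1 - z p * cnj (z p)))\<^sup>2 * (pth z p * cnj (z p) + z p * cnj (pth z p)))"
    by (simp add: algebra_simps)
  then show ?thesis
    unfolding lam_def[symmetric]
    by (rule has_partials_eq_rhs)
      (simp_all add: w_def y_def cnj_lam power2_eq_square lam_def[abs_def] algebra_simps)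
qed

text \<open>Differentiating \<open>lam\<close> produces only the real part of
  \<open>cnj z * w\<close> as a factor of \<open>w\<close>, while \<open>W\<close> contains the
  whole product; the difference is the imaginary connection coefficient \<open>om1\<close>. The
  angular derivative works the same way with \<open>y\<close> and \<open>om2\<close>.\<close>

lemma hp_w: "has_partials w (\<lambda>p. W p - om1 p * w p) (\<lambda>p. U p - om2 p * w p)"
proof -
  have "has_partials (\<lambda>p. lam p * pt z p)
     (\<lambda>p. lam p * (cnj (z p) * w p + z p * cnj (w p)) * (1/2) * pt z p + lam p * pt (pt z) p)
     (\<lambda>p. lam p * (cnj (z p) * y p + z p * cnj (y p)) * (1/2) * pt z p + lam p * pth (pt z) p)"
    by (intro has_partials_mult hp_lam hp_z1)
  then show ?thesis
    unfolding w_def[symmetric]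
    by (rule has_partials_eq_rhs) (simp_all add: W_def U_def om1_def om2_def w_def algebra_simps)
qed

lemma hp_y: "has_partials y (\<lambda>p. U p - om1 p * y p) (\<lambda>p. Y p - om2 p * y p)"
proof -
  have "has_partials (\<lambda>p. lam p * pth z p)
     (\<lambda>p. lam p * (cnj (z p) * w p + z p * cnj (w p)) * (1/2) * pth z p + lam p * pth (pt z) p)
     (\<lambda>p. lam p * (cnj (z p) * y p + z p * cnj (y p)) * (1/2) * pth z p + lam p * pth (pth z) p)"
    by (intro has_partials_mult hp_lam hp_z2)
  then show ?thesis
    unfolding y_def[symmetric]
    by (rule has_partials_eq_rhs) (simp_all add: Y_def U_def om1_def om2_def y_def algebra_simps)
qed

text \<open>The derivatives of the weights combine with the connection terms to
  \<open>z * |w|^2\<close> and \<open>z * |y|^2\<close>, which cancel the right-hand side of the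
  equation. What remains is the wave map equation between the two covariant accelerations.\<close>

lemma W_eq: "W p = exp (- 2 * of_real (fst p)) * Y p"
proof -
  obtain t x where p: "p = (t, x)" by fastforce
  \<comment> \<open>The weight is \<open>lam\<close> squared over 4, and one of the two factors
    \<open>lam\<close> turns a derivative of \<open>z\<close> into \<open>w\<close> or
    \<open>y\<close>.\<close>
  have quarter: "g / complex_of_real ((1 - (norm (z q))\<^sup>2)\<^sup>2) = (1/4) * (lam q * (lam q * g))" for g q
    by (simp add: lam_of_real power2_eq_square)
  have lw: "has_partials (\<lambda>q. (1/4) * (lam q * w q))
     (\<lambda>q. 0 * (lam q * w q) + (1/4) * (lam q * (cnj (z q) * w q + z q * cnj (w q)) * (1/2) * w q
        + lam q * (W q - om1 q * w q)))
     (\<lambda>q. 0 * (lam q * w q) + (1/4) * (lam q * (cnj (z q) * y q + z q * cnj (y q)) * (1/2) * w q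
        + lam q * (U q - om2 q * w q)))"
    by (intro has_partials_mult has_partials_const hp_lam hp_w)
  have ly: "has_partials (\<lambda>q. (1/4) * (lam q * y q))
     (\<lambda>q. 0 * (lam q * y q) + (1/4) * (lam q * (cnj (z q) * w q + z q * cnj (w q)) * (1/2) * y q
        + lam q * (U q - om1 q * y q)))
     (\<lambda>q. 0 * (lam q * y q) + (1/4) * (lam q * (cnj (z q) * y q + z q * cnj (y q)) * (1/2) * y q
        + lam q * (Y q - om2 q * y q)))"
    by (intro has_partials_mult has_partials_const hp_lam hp_y)
  have a: "vector_derivative (\<lambda>s. pt z (s, x) / complex_of_real ((1 - (norm (z (s, x)))\<^sup>2)\<^sup>2)) (at t)
     = (1/4) * (lam p * (cnj (z p) * w p + z p * cnj (w p)) * (1/2) * w p + lam p * (W p - om1 p * w p))"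
    using vector_derivative_at[OF has_partials_1[OF lw, of x t]]
    unfolding quarter w_def[symmetric] p by simp
  have b: "vector_derivative (\<lambda>s. pth z (t, s) / complex_of_real ((1 - (norm (z (t, s)))\<^sup>2)\<^sup>2)) (at x)
     = (1/4) * (lam p * (cnj (z p) * y p + z p * cnj (y p)) * (1/2) * y p + lam p * (Y p - om2 p * y p))"
    using vector_derivative_at[OF has_partials_2[OF ly, of t x]]
    unfolding quarter y_def[symmetric] p by simp
  define e where "e = complex_of_real (exp (-2 * t))"
  have nn: "complex_of_real ((norm g)\<^sup>2) = g * cnj g" for g
    using complex_norm_square by simp
  have c: "2 * z p / complex_of_real ((1 - (norm (z p))\<^sup>2) ^ 3)
        * complex_of_real ((norm (pt z p))\<^sup>2 - exp (-2 * t) * (norm (pth z p))\<^sup>2)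
      = (1/4) * (lam p * z p * (w p * cnj (w p) - e * (y p * cnj (y p))))"
  proof -
    have "2 / complex_of_real ((1 - (norm (z p))\<^sup>2) ^ 3) = (1/4) * lam p ^ 3"
      by (simp add: lam_of_real power_divide)
    then have "2 / complex_of_real ((1 - (norm (z p))\<^sup>2) ^ 3) * z p = (1/4) * lam p ^ 3 * z p"
      by (simp only:)
    then have "2 * z p / complex_of_real ((1 - (norm (z p))\<^sup>2) ^ 3) = (1/4) * lam p ^ 3 * z p"
      by (simp only: times_divide_eq_left)
    moreover have "complex_of_real ((norm (pt z p))\<^sup>2 - exp (-2 * t) * (norm (pth z p))\<^sup>2)
      = pt z p * cnj (pt z p) - e * (pth z p * cnj (pth z p))"
      by (simp only: of_real_diff of_real_mult nn e_def)
    ultimately have "2 * z p / complex_of_real ((1 - (norm (z p))\<^sup>2) ^ 3)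
        * complex_of_real ((norm (pt z p))\<^sup>2 - exp (-2 * t) * (norm (pth z p))\<^sup>2)
      = (1/4) * lam p ^ 3 * z p * (pt z p * cnj (pt z p) - e * (pth z p * cnj (pth z p)))"
      by (simp only:)
    also have "\<dots> = (1/4) * (lam p * z p * (w p * cnj (w p) - e * (y p * cnj (y p))))"
      by (simp add: w_def y_def cnj_lam power3_eq_cube right_diff_distrib ac_simps)
    finally show ?thesis .
  qed
  from pde[where t = t and \<theta> = x]
  have "(1/4) * (lam p * (cnj (z p) * w p + z p * cnj (w p)) * (1/2) * w p + lam p * (W p - om1 p * w p))
     - e * ((1/4) * (lam p * (cnj (z p) * y p + z p * cnj (y p)) * (1/2) * y p + lam p * (Y p - om2 p * y p)))
     = (1/4) * (lam p * z p * (w p * cnj (w p) - e * (y p * cnj (y p))))"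
    using a b c by (simp only: p e_def)
  then have "lam p * (W p - e * Y p) = 0"
    by (simp add: om1_def om2_def algebra_simps)
  then show ?thesis
    using lam_nz by (simp add: e_def p exp_of_real[symmetric])
qed

section \<open>Third-order derivatives and the commutator of the covariant derivatives\<close>

definition "U1 p = lam p * (cnj (z p) * w p + z p * cnj (w p)) * (1/2) * pth (pt z) p + lam p * pth (pt (pt z)) p
   + ((cnj (pt z p) * w p + cnj (z p) * (W p - om1 p * w p)) * y p + cnj (z p) * w p * (U p - om1 p * y p))"
definition "U2 p = lam p * (cnj (z p) * y p + z p * cnj (y p)) * (1/2) * pth (pt z) p + lam p * pth (pth (pt z)) p
   + ((cnj (pth z p) * w p + cnj (z p) * (U p - om2 p * w p)) * y p + cnj (z p) * w p * (Y p - om2 p * y p))"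
definition "Y1 p = lam p * (cnj (z p) * w p + z p * cnj (w p)) * (1/2) * pth (pth z) p + lam p * pth (pth (pt z)) p
   + ((cnj (pt z p) * y p + cnj (z p) * (U p - om1 p * y p)) * y p + cnj (z p) * y p * (U p - om1 p * y p))"
definition "Y2 p = lam p * (cnj (z p) * y p + z p * cnj (y p)) * (1/2) * pth (pth z) p + lam p * pth (pth (pth z)) p
   + ((cnj (pth z p) * y p + cnj (z p) * (Y p - om2 p * y p)) * y p + cnj (z p) * y p * (Y p - om2 p * y p))"
definition "W2 p = lam p * (cnj (z p) * y p + z p * cnj (y p)) * (1/2) * pt (pt z) p + lam p * pth (pt (pt z)) p
   + ((cnj (pth z p) * w p + cnj (z p) * (U p - om2 p * w p)) * w p + cnj (z p) * w p * (U p - om2 p * w p))"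

lemma hp_U: "has_partials U U1 U2"
  unfolding U1_def[abs_def] U2_def[abs_def]
  by (subst U_def[abs_def]) (intro has_partials_add has_partials_mult hp_lam hp_z12 hp_w hp_y has_partials_cnj hp_z)

lemma hp_Y: "has_partials Y Y1 Y2"
  unfolding Y1_def[abs_def] Y2_def[abs_def]
  by (subst Y_def[abs_def]) (intro has_partials_add has_partials_mult hp_lam hp_z22 hp_w hp_y has_partials_cnj hp_z)

text \<open>The exponential factor in \<open>W_eq\<close> is constant in the angle, so that equation
  can be differentiated in the angle directly.\<close>

lemma W2_eq: "W2 p = exp (- 2 * of_real (fst p)) * Y2 p"
proof -
  obtain W1 where W: "has_partials W W1 W2"
    unfolding W_def[abs_def] W2_def[abs_def]
    using has_partials_add[OF has_partials_mult[OF hp_lam hp_z11] has_partials_mult[OF has_partials_mult[OF has_partials_cnj[OF hp_z] hp_w] hp_w]]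
    by blast
  have e: "has_partials (\<lambda>p. exp (- 2 * complex_of_real (fst p)))
     (\<lambda>p. - 2 * exp (- 2 * complex_of_real (fst p))) (\<lambda>p. 0)"
    by (rule has_partials_fst, rule has_vector_derivative_real_field) (auto intro!: derivative_eq_intros)
  have "has_partials W (\<lambda>p. - 2 * exp (- 2 * complex_of_real (fst p)) * Y p + exp (- 2 * complex_of_real (fst p)) * Y1 p)
     (\<lambda>p. 0 * Y p + exp (- 2 * complex_of_real (fst p)) * Y2 p)"
    unfolding W_eq[abs_def] by (intro has_partials_mult e hp_Y)
  from has_partials_unique(2)[OF W this] show ?thesis by simp
qed

lemma zt_eq: "pt z p = w p * (1 - z p * cnj (z p)) / 2"
  by (simp only: w_def mult.assoc mult.left_commute[of "lam p"] inv_lam) simp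

lemma zth_eq: "pth z p = y p * (1 - z p * cnj (z p)) / 2"
  by (simp only: y_def mult.assoc mult.left_commute[of "lam p"] inv_lam) simp

lemma cnj_zt_eq: "cnj (pt z p) = cnj (w p) * (1 - cnj (z p) * z p) * (1/2)"
  and cnj_zth_eq: "cnj (pth z p) = cnj (y p) * (1 - cnj (z p) * z p) * (1/2)"
  by (simp_all add: zt_eq zth_eq)

text \<open>The commutator of the covariant derivatives is the curvature term \<open>i Im (cnj w * y)\<close>.\<close>

lemma commute_U: "U1 p + om1 p * U p = W2 p + om2 p * W p + kap p * w p"
proof -
  have "lam p * pth (pt z) p = U p - cnj (z p) * w p * y p"
    "lam p * pt (pt z) p = W p - cnj (z p) * w p * w p" by (simp_all add: U_def W_def)
  note this[symmetric]
  \<comment> \<open>Second derivatives of \<open>z\<close> are replaced by covariant ones. The only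
    remaining higher derivative is the third one shared by both sides, the variable \<open>N\<close>
    of the polynomial identity.\<close>
  then have second: "lam p * q * (1/2) * pth (pt z) p = q * (1/2) * (U p - cnj (z p) * w p * y p)"
    "lam p * q * (1/2) * pt (pt z) p = q * (1/2) * (W p - cnj (z p) * w p * w p)" for q
    by simp_all
  show ?thesis
    unfolding U1_def W2_def second kap_def cnj_zt_eq cnj_zth_eq om1_def om2_def
    by (rule commutator_identity_1) simp
qed

lemma commute_Y: "Y1 p + om1 p * Y p = U2 p + om2 p * U p + kap p * y p"
proof -
  have "lam p * pth (pt z) p = U p - cnj (z p) * w p * y p"
    "lam p * pth (pth z) p = Y p - cnj (z p) * y p * y p" by (simp_all add: U_def Y_def)
  note this[symmetric]
  then have second: "lam p * q * (1/2) * pth (pt z) p = q * (1/2) * (U p - cnj (z p) * w p * y p)"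
    "lam p * q * (1/2) * pth (pth z) p = q * (1/2) * (Y p - cnj (z p) * y p * y p)" for q
    by simp_all
  show ?thesis
    unfolding Y1_def U2_def second kap_def cnj_zt_eq cnj_zth_eq om1_def om2_def
    by (rule commutator_identity_2) simp
qed

section \<open>Null components and their evolution along characteristics\<close>

definition "us s p = w p + of_real (s * exp (- fst p)) * y p"
text \<open>The covariant angular derivative of \<open>us s\<close>, because the exponential
  coefficient does not depend on the angle.\<close>

definition "Xs s p = U p + of_real (s * exp (- fst p)) * Y p"

lemma has_partials_exp:
  "has_partials (\<lambda>p. complex_of_real (s * exp (- fst p))) (\<lambda>p. - complex_of_real (s * exp (- fst p))) (\<lambda>p. 0)"
proof (rule has_partials_fst[of "\<lambda>t. complex_of_real (s * exp (- t))" "\<lambda>t. - complex_of_real (s * exp (- t))"])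
  fix t :: real
  have "((\<lambda>t. s * exp (- t)) has_real_derivative - (s * exp (- t))) (at t)"
    by (auto intro!: derivative_eq_intros)
  from has_vector_derivative_of_real[OF this]
  show "((\<lambda>t. complex_of_real (s * exp (- t))) has_vector_derivative - complex_of_real (s * exp (- t))) (at t)"
    by simp
qed

lemma hp_us: "has_partials (us s)
    (\<lambda>p. (W p - om1 p * w p) + (- of_real (s * exp (- fst p)) * y p + of_real (s * exp (- fst p)) * (U p - om1 p * y p)))
    (\<lambda>p. (U p - om2 p * w p) + (0 * y p + of_real (s * exp (- fst p)) * (Y p - om2 p * y p)))"
  unfolding us_def[abs_def] by (intro has_partials_add has_partials_mult has_partials_exp hp_w hp_y)

lemma hp_Xs: "has_partials (Xs s)
    (\<lambda>p. U1 p + (- of_real (s * exp (- fst p)) * Y p + of_real (s * exp (- fst p)) * Y1 p))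
    (\<lambda>p. U2 p + (0 * Y p + of_real (s * exp (- fst p)) * Y2 p))"
  unfolding Xs_def[abs_def] by (intro has_partials_add has_partials_mult has_partials_exp hp_U hp_Y)

lemma Re_om: "Re (om1 p) = 0" "Re (om2 p) = 0"
  by (simp_all add: om1_def om2_def)

text \<open>Infinitesimal rotations preserve norms. This removes the connection terms
  \<open>om1\<close> and \<open>om2\<close> from every derivative of a squared norm.\<close>

lemma Re_skew: "Re a = 0 \<Longrightarrow> Re (cnj g * (b - a * g)) = Re (cnj g * b)"
  by (simp add: algebra_simps)

lemma characteristic_derivative:
  "((\<lambda>r. \<theta> + s * (exp (- r) - exp (- t))) has_real_derivative - (s * exp (- t))) (at t)"
  by (auto intro!: derivative_eq_intros)

lemma exp_squared_complex:
  "s * s = 1 \<Longrightarrow> complex_of_real (s * exp (- t)) * complex_of_real (s * exp (- t)) = exp (- 2 * of_real t)"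
proof -
  assume s: "s * s = 1"
  have "complex_of_real (s * exp (- t)) * complex_of_real (s * exp (- t))
    = complex_of_real ((s * s) * (exp (- t) * exp (- t)))"
    by simp
  also have "\<dots> = exp (- 2 * of_real t)"
    by (simp add: s exp_add[symmetric] flip: exp_of_real)
  finally show ?thesis .
qed

text \<open>The derivative along this curve is \<open>D_t - s * exp (- t) * D_\<theta>\<close>. By
  \<open>W_eq\<close> and \<open>D_t y = U = D_\<theta> w\<close> all second-order terms cancel.
  Only the derivative of the coefficient survives, namely \<open>- s * exp (- t) * y\<close>, which
  is half of \<open>us (- s) - us s\<close>.\<close>

lemma us_along_characteristic:
  assumes s: "s * s = 1"
  shows "((\<lambda>r. (norm (us s (r, \<theta> + s * (exp (- r) - exp (- t)))))\<^sup>2) has_real_derivative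
    (Re (cnj (us s (t, \<theta>)) * us (- s) (t, \<theta>)) - (norm (us s (t, \<theta>)))\<^sup>2)) (at t)"
proof -
  let ?p = "(t, \<theta>)"
  define \<epsilon> where "\<epsilon> = complex_of_real (s * exp (- t))"
  have W: "W ?p = \<epsilon> * \<epsilon> * Y ?p"
    unfolding \<epsilon>_def exp_squared_complex[OF s] by (simp add: W_eq)
  have "((\<lambda>r. us s (r, \<theta> + s * (exp (- r) - exp (- t)))) has_vector_derivative
     (- (\<epsilon> * y ?p) - (om1 ?p - \<epsilon> * om2 ?p) * us s ?p)) (at t)"
    using has_partials_curve[OF hp_us[of s] characteristic_derivative[of \<theta> s t]]
    by (simp add: \<epsilon>_def[symmetric] W us_def algebra_simps del: of_real_mult)
  from norm_squared_has_derivative[OF this]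
  have 1: "((\<lambda>r. (norm (us s (r, \<theta> + s * (exp (- r) - exp (- t)))))\<^sup>2) has_real_derivative
     2 * Re (cnj (us s ?p) * (- (\<epsilon> * y ?p) - (om1 ?p - \<epsilon> * om2 ?p) * us s ?p))) (at t)"
    by simp
  have "Re (om1 ?p - \<epsilon> * om2 ?p) = 0" by (simp add: Re_om \<epsilon>_def)
  from Re_skew[OF this]
  have 2: "Re (cnj (us s ?p) * (- (\<epsilon> * y ?p) - (om1 ?p - \<epsilon> * om2 ?p) * us s ?p)) = Re (cnj (us s ?p) * (- (\<epsilon> * y ?p)))" .
  have "2 * (\<epsilon> * y ?p) = us s ?p - us (- s) ?p" by (simp add: us_def \<epsilon>_def)
  then have "cnj (us s ?p) * (2 * (\<epsilon> * y ?p)) = cnj (us s ?p) * (us s ?p - us (- s) ?p)"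
    by (simp only:)
  then have "2 * (cnj (us s ?p) * (- (\<epsilon> * y ?p))) = cnj (us s ?p) * us (- s) ?p - us s ?p * cnj (us s ?p)"
    by algebra
  also have "\<dots> = cnj (us s ?p) * us (- s) ?p - of_real ((norm (us s ?p))\<^sup>2)"
    by (simp only: complex_norm_square)
  finally have "Re (2 * (cnj (us s ?p) * (- (\<epsilon> * y ?p))))
     = Re (cnj (us s ?p) * us (- s) ?p - of_real ((norm (us s ?p))\<^sup>2))" by (simp only:)
  then have 3: "2 * Re (cnj (us s ?p) * (- (\<epsilon> * y ?p))) = Re (cnj (us s ?p) * us (- s) ?p) - (norm (us s ?p))\<^sup>2"
    by simp
  show ?thesis using 1 unfolding 2 3 .
qed

text \<open>The cancellation for \<open>us\<close> repeats one order higher; commuting the covariant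
  derivatives adds the curvature term \<open>kap * us s\<close>.\<close>

lemma Xs_along_characteristic:
  assumes s: "s * s = 1"
  shows "((\<lambda>r. (norm (Xs s (r, \<theta> + s * (exp (- r) - exp (- t)))))\<^sup>2) has_real_derivative
    (2 * Re (cnj (Xs s (t, \<theta>)) * (kap (t, \<theta>) * us s (t, \<theta>)))
     + Re (cnj (Xs s (t, \<theta>)) * Xs (- s) (t, \<theta>)) - (norm (Xs s (t, \<theta>)))\<^sup>2)) (at t)"
proof -
  let ?p = "(t, \<theta>)"
  define \<epsilon> where "\<epsilon> = complex_of_real (s * exp (- t))"
  have W: "W ?p = \<epsilon> * \<epsilon> * Y ?p" and W2: "W2 ?p = \<epsilon> * \<epsilon> * Y2 ?p"
    unfolding \<epsilon>_def exp_squared_complex[OF s] by (simp_all add: W_eq W2_eq)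
  have U1: "U1 ?p = \<epsilon> * \<epsilon> * Y2 ?p + om2 ?p * (\<epsilon> * \<epsilon> * Y ?p) + kap ?p * w ?p - om1 ?p * U ?p"
    using commute_U[of ?p] by (simp add: W W2 algebra_simps)
  have Y1: "Y1 ?p = U2 ?p + om2 ?p * U ?p + kap ?p * y ?p - om1 ?p * Y ?p"
    using commute_Y[of ?p] by (simp add: algebra_simps)
  have "((\<lambda>r. Xs s (r, \<theta> + s * (exp (- r) - exp (- t)))) has_vector_derivative
     (kap ?p * us s ?p - \<epsilon> * Y ?p - (om1 ?p - \<epsilon> * om2 ?p) * Xs s ?p)) (at t)"
    using has_partials_curve[OF hp_Xs[of s] characteristic_derivative[of \<theta> s t]]
    by (simp add: \<epsilon>_def[symmetric] U1 Y1 us_def Xs_def algebra_simps del: of_real_mult)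
  from norm_squared_has_derivative[OF this]
  have 1: "((\<lambda>r. (norm (Xs s (r, \<theta> + s * (exp (- r) - exp (- t)))))\<^sup>2) has_real_derivative
     2 * Re (cnj (Xs s ?p) * (kap ?p * us s ?p - \<epsilon> * Y ?p - (om1 ?p - \<epsilon> * om2 ?p) * Xs s ?p))) (at t)"
    by simp
  have "Re (om1 ?p - \<epsilon> * om2 ?p) = 0" by (simp add: Re_om \<epsilon>_def)
  from Re_skew[OF this]
  have 2: "Re (cnj (Xs s ?p) * (kap ?p * us s ?p - \<epsilon> * Y ?p - (om1 ?p - \<epsilon> * om2 ?p) * Xs s ?p))
     = Re (cnj (Xs s ?p) * (kap ?p * us s ?p - \<epsilon> * Y ?p))" .
  have "2 * (\<epsilon> * Y ?p) = Xs s ?p - Xs (- s) ?p" by (simp add: Xs_def \<epsilon>_def)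
  then have "cnj (Xs s ?p) * (2 * (\<epsilon> * Y ?p)) = cnj (Xs s ?p) * (Xs s ?p - Xs (- s) ?p)"
    by (simp only:)
  then have "2 * (cnj (Xs s ?p) * (\<epsilon> * Y ?p)) = Xs s ?p * cnj (Xs s ?p) - cnj (Xs s ?p) * Xs (- s) ?p"
    by algebra
  also have "\<dots> = of_real ((norm (Xs s ?p))\<^sup>2) - cnj (Xs s ?p) * Xs (- s) ?p"
    by (simp only: complex_norm_square)
  finally have "Re (2 * (cnj (Xs s ?p) * (\<epsilon> * Y ?p)))
     = Re (of_real ((norm (Xs s ?p))\<^sup>2) - cnj (Xs s ?p) * Xs (- s) ?p)" by (simp only:)
  then have 3: "2 * Re (cnj (Xs s ?p) * (\<epsilon> * Y ?p)) = (norm (Xs s ?p))\<^sup>2 - Re (cnj (Xs s ?p) * Xs (- s) ?p)"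
    by simp
  have 4: "Re (cnj (Xs s ?p) * (kap ?p * us s ?p - \<epsilon> * Y ?p))
    = Re (cnj (Xs s ?p) * (kap ?p * us s ?p)) - Re (cnj (Xs s ?p) * (\<epsilon> * Y ?p))"
    by (simp only: right_diff_distrib minus_complex.sel)
  have "2 * Re (cnj (Xs s ?p) * (kap ?p * us s ?p - \<epsilon> * Y ?p - (om1 ?p - \<epsilon> * om2 ?p) * Xs s ?p))
    = 2 * Re (cnj (Xs s ?p) * (kap ?p * us s ?p)) + Re (cnj (Xs s ?p) * Xs (- s) ?p) - (norm (Xs s ?p))\<^sup>2"
    using 2 3 4 by linarith
  then show ?thesis using 1 by (simp only:)
qed

lemma y_along_time:
  "((\<lambda>r. (norm (y (r, \<theta>)))\<^sup>2) has_real_derivative 2 * Re (cnj (y (t, \<theta>)) * U (t, \<theta>))) (at t)"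
  using norm_squared_has_derivative[OF has_partials_1[OF hp_y, of \<theta> t]]
  by (simp only: Re_skew[OF Re_om(1)])

lemma norm_kap_le: "norm (kap p) \<le> norm (w p) * norm (y p)"
proof -
  have "norm (cnj (w p) * y p - w p * cnj (y p)) \<le> norm (cnj (w p) * y p) + norm (w p * cnj (y p))"
    by (rule norm_triangle_ineq4)
  then show ?thesis by (simp add: kap_def norm_mult norm_divide)
qed

end

section \<open>A maximum principle along characteristics\<close>

text \<open>The point is chosen before the function, so that one representative serves a whole
  family of periodic functions.\<close>

lemma periodic_representative:
  "\<exists>x\<in>{0..2*pi}. \<forall>f :: real \<Rightarrow> 'a. (\<forall>\<theta>. f (\<theta> + 2 * pi) = f \<theta>) \<longrightarrow> f \<theta> = f x"
proof -
  have shift: "f (\<theta> + of_int n * (2 * pi)) = f \<theta>"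
    if "\<forall>\<theta>. f (\<theta> + 2 * pi) = f \<theta>" for f :: "real \<Rightarrow> 'a" and n
  proof (induction n rule: int_induct[where k = 0])
    case (step1 i)
    then show ?case using that[rule_format, of "\<theta> + of_int i * (2 * pi)"] by (simp add: algebra_simps)
  next
    case (step2 i)
    then show ?case using that[rule_format, of "\<theta> + of_int (i - 1) * (2 * pi)"] by (simp add: algebra_simps)
  qed simp
  define n where "n = \<lfloor>\<theta> / (2 * pi)\<rfloor>"
  have pi2: "0 < 2 * pi" by simp
  have "of_int n * (2 * pi) \<le> \<theta>" "\<theta> < (of_int n + 1) * (2 * pi)"
    using floor_correct[of "\<theta> / (2 * pi)"]
    unfolding n_def pos_le_divide_eq[OF pi2] pos_divide_less_eq[OF pi2] by simp_all
  then have "\<theta> + of_int (- n) * (2 * pi) \<in> {0..2*pi}"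
    by (simp add: algebra_simps)
  moreover have "\<forall>f :: real \<Rightarrow> 'a. (\<forall>\<theta>. f (\<theta> + 2 * pi) = f \<theta>) \<longrightarrow> f \<theta> = f (\<theta> + of_int (- n) * (2 * pi))"
    by (intro allI impI shift[symmetric]) auto
  ultimately show ?thesis by blast
qed

text \<open>A positive maximum over a compact time interval, all angles and all indices cannot lie
  at \<open>t0\<close>, and following its own characteristic backwards would produce a larger value.
  The index \<open>s\<close> is also the speed parameter of the characteristic; \<open>s = 0\<close>
  gives a line of constant angle.\<close>

lemma maximum_principle_characteristics:
  fixes G :: "real \<Rightarrow> real \<times> real \<Rightarrow> real"
  assumes "finite S"
    and cont: "\<And>s. s \<in> S \<Longrightarrow> continuous_on UNIV (G s)"
    and per: "\<And>s t \<theta>. s \<in> S \<Longrightarrow> G s (t, \<theta> + 2 * pi) = G s (t, \<theta>)"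
    and init: "\<And>s \<theta>. s \<in> S \<Longrightarrow> G s (t0, \<theta>) \<le> 0"
    and step: "\<And>s t \<theta>. s \<in> S \<Longrightarrow> t > t0 \<Longrightarrow> G s (t, \<theta>) > 0 \<Longrightarrow>
       (\<And>s'. s' \<in> S \<Longrightarrow> G s' (t, \<theta>) \<le> G s (t, \<theta>)) \<Longrightarrow>
       \<exists>d<0. ((\<lambda>r. G s (r, \<theta> + s * (exp (- r) - exp (- t)))) has_real_derivative d) (at t)"
    and "s \<in> S" "t \<ge> t0"
  shows "G s (t, \<theta>) \<le> 0"
proof (rule ccontr)
  assume "\<not> G s (t, \<theta>) \<le> 0"
  then have pos: "G s (t, \<theta>) > 0" by simp
  have red: "\<exists>x\<in>{0..2*pi}. \<forall>s\<in>S. \<forall>t. G s (t, \<theta>) = G s (t, x)" for \<theta>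
  proof -
    obtain x where "x \<in> {0..2*pi}"
      and x: "\<And>f :: real \<Rightarrow> real. (\<forall>\<theta>. f (\<theta> + 2 * pi) = f \<theta>) \<Longrightarrow> f \<theta> = f x"
      using periodic_representative[where 'a = real] by meson
    have "G s (t, \<theta>) = G s (t, x)" if "s \<in> S" for s t
      using x[of "\<lambda>\<theta>. G s (t, \<theta>)"] per[OF that] by simp
    then show ?thesis using \<open>x \<in> {0..2*pi}\<close> by blast
  qed
  define K where "K = {t0..t} \<times> {0..2*pi}"
  have K: "compact K" "K \<noteq> {}"
    using \<open>t \<ge> t0\<close> by (auto simp: K_def intro!: compact_Times)
  have "\<exists>p\<in>K. \<forall>q\<in>K. G s q \<le> G s p" if "s \<in> S" for s
    by (rule continuous_attains_sup[OF K continuous_on_subset[OF cont[OF that]]]) simp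
  then obtain P where P: "\<And>s. s \<in> S \<Longrightarrow> P s \<in> K" "\<And>s q. s \<in> S \<Longrightarrow> q \<in> K \<Longrightarrow> G s q \<le> G s (P s)"
    by metis
  obtain m where m: "m \<in> S" "\<And>s. s \<in> S \<Longrightarrow> G s (P s) \<le> G m (P m)"
  proof -
    have "Max ((\<lambda>s. G s (P s)) ` S) \<in> (\<lambda>s. G s (P s)) ` S"
      using \<open>finite S\<close> \<open>s \<in> S\<close> by (intro Max_in) auto
    then obtain m where "m \<in> S" "Max ((\<lambda>s. G s (P s)) ` S) = G m (P m)" by auto
    then show thesis using that[of m] \<open>finite S\<close> by (metis Max_ge finite_imageI imageI)
  qed
  obtain t1 x where p: "P m = (t1, x)" by fastforce
  have t1: "t0 \<le> t1" "t1 \<le> t" using P(1)[OF m(1)] by (auto simp: p K_def)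
  have max: "G s' (t', \<theta>') \<le> G m (t1, x)" if "s' \<in> S" "t0 \<le> t'" "t' \<le> t" for s' t' \<theta>'
  proof -
    obtain x' where "x' \<in> {0..2*pi}" and eq: "\<forall>s\<in>S. \<forall>t. G s (t, \<theta>') = G s (t, x')"
      using red[of \<theta>'] by blast
    then have "G s' (t', x') \<le> G s' (P s')" using that by (intro P) (auto simp: K_def)
    then show ?thesis using eq m(2)[OF that(1)] p that(1) by auto
  qed
  have posm: "G m (t1, x) > 0"
    using max[OF \<open>s \<in> S\<close> \<open>t \<ge> t0\<close> order_refl, of \<theta>] pos by simp
  then have "t1 > t0" using init[OF m(1), of x] t1 by (cases "t1 = t0") auto
  then obtain d where d: "d < 0"
     "((\<lambda>r. G m (r, x + m * (exp (- r) - exp (- t1)))) has_real_derivative d) (at t1)"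
    using step[OF m(1) \<open>t1 > t0\<close> posm max[OF _ t1]] by auto
  \<comment> \<open>A negative derivative means strictly larger values shortly before
    \<open>t1\<close>, which contradicts maximality as long as \<open>t0\<close> is not
    crossed.\<close>
  from DERIV_neg_dec_left[OF d(2,1)] obtain \<delta> where \<delta>: "\<delta> > 0"
    "\<And>h. 0 < h \<Longrightarrow> h < \<delta> \<Longrightarrow> G m (t1, x) < G m (t1 - h, x + m * (exp (- (t1 - h)) - exp (- t1)))"
    by auto
  define h where "h = min (\<delta> / 2) (t1 - t0)"
  have "h > 0" "h < \<delta>" "t1 - h \<ge> t0" "t1 - h \<le> t"
    using \<delta>(1) \<open>t1 > t0\<close> t1 by (auto simp: h_def min_def)
  then show False using \<delta>(2)[of h] max[OF m(1), of "t1 - h" "x + m * (exp (- (t1 - h)) - exp (- t1))"] by linarith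
qed

section \<open>Curves in the hyperbolic disc with small acceleration\<close>

text \<open>At its first zero the function arrives from positive values, whereas \<open>zero\<close>
  forces it to be increasing there.\<close>

lemma barrier:
  fixes d :: "real \<Rightarrow> real"
  assumes deriv: "\<And>x. a \<le> x \<Longrightarrow> x \<le> b \<Longrightarrow> (d has_real_derivative d' x) (at x)"
    and "d a > 0"
    and zero: "\<And>x. a \<le> x \<Longrightarrow> x \<le> b \<Longrightarrow> d x = 0 \<Longrightarrow> d' x > 0"
    and x: "a \<le> x" "x \<le> b"
  shows "d x > 0"
proof (rule ccontr)
  assume "\<not> d x > 0"
  have cont: "continuous_on {a..x} d"
    using deriv x by (intro continuous_at_imp_continuous_on ballI) (meson DERIV_isCont atLeastAtMost_iff order_trans)
  have "closed ({a..x} \<inter> d -` {..0})"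
    by (rule continuous_on_closed_vimage[THEN iffD1, rule_format, OF _ cont, of "{..0}", simplified Int_commute]) auto
  then have "compact ({a..x} \<inter> d -` {..0})"
    using compact_Int_closed[of "{a..x}" "{a..x} \<inter> d -` {..0}"] by (simp add: Int_absorb1)
  moreover have "{a..x} \<inter> d -` {..0} \<noteq> {}"
    using \<open>\<not> d x > 0\<close> x by (auto intro!: exI[of _ x])
  ultimately obtain m where m: "m \<in> {a..x} \<inter> d -` {..0}" "\<And>y. y \<in> {a..x} \<inter> d -` {..0} \<Longrightarrow> m \<le> y"
    using compact_attains_inf by metis
  have before: "d y > 0" if "a \<le> y" "y < m" for y
    using m(2)[of y] m(1) that by force
  have "m > a" using m(1) \<open>d a > 0\<close> by (cases "m = a") auto
  have "d m = 0"
  proof (rule ccontr)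
    assume "d m \<noteq> 0"
    then have "d m < 0" using m(1) by auto
    then obtain y where "a \<le> y" "y \<le> m" "d y = 0"
      using IVT2'[of d m 0 a] \<open>d a > 0\<close> \<open>m > a\<close> m(1) continuous_on_subset[OF cont, of "{a..m}"] by force
    then show False using before[of y] \<open>d m \<noteq> 0\<close> by (cases "y = m") auto
  qed
  then have "d' m > 0" using zero m(1) x by auto
  from DERIV_pos_inc_left[OF deriv this] m(1) x obtain \<delta> where
    \<delta>: "\<delta> > 0" "\<And>h. 0 < h \<Longrightarrow> h < \<delta> \<Longrightarrow> d (m - h) < d m" by auto
  define h where "h = min (\<delta> / 2) (m - a)"
  have "h > 0" "h < \<delta>" "m - h \<ge> a" using \<delta>(1) \<open>m > a\<close> by (auto simp: h_def min_def)
  then show False using \<delta>(2)[of h] before[of "m - h"] \<open>d m = 0\<close> by auto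
qed

lemma DERIV_nonpos_le:
  fixes g :: "real \<Rightarrow> real"
  assumes "a \<le> b" "\<And>x. a \<le> x \<Longrightarrow> x \<le> b \<Longrightarrow> \<exists>y. (g has_real_derivative y) (at x) \<and> y \<le> 0"
  shows "g b \<le> g a"
  using DERIV_nonpos_imp_nonincreasing[of a b g] assms by blast

text \<open>Converts exponential decay into the algebraic rate of the theorem, uniformly in the
  exponent.\<close>

lemma exp_minus_le_inverse: "x > 0 \<Longrightarrow> exp (- x) \<le> 1 / (x :: real)"
  using less_imp_le[OF exp_gt_self[of x]] by (simp add: exp_minus field_simps)

text \<open>With \<rho> the hyperbolic distance to the origin, the quotient on the right is cosh
  \<rho>, and e^\<rho> \<le> 2 cosh \<rho>.\<close>

lemma hypvec_norm_le:
  assumes "norm z < 1"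
  shows "norm (hypvec z) \<le> ln 2 + ln ((1 + (norm z)\<^sup>2) / (1 - (norm z)\<^sup>2))"
proof -
  define n where "n = norm z"
  have n: "0 \<le> n" "n < 1" using assms by (auto simp: n_def)
  have n2: "n\<^sup>2 < 1" using n by (simp add: power_less_one_iff)
  have "(1 + n) / (1 - n) = (1 + n)\<^sup>2 / (1 - n\<^sup>2)"
    using n n2 by (simp add: divide_simps power2_eq_square algebra_simps)
  also have "\<dots> \<le> (2 * (1 + n\<^sup>2)) / (1 - n\<^sup>2)"
    using n2 sum_squares_bound[of 1 n] by (intro divide_right_mono) (auto simp: power2_eq_square algebra_simps)
  finally have le: "(1 + n) / (1 - n) \<le> 2 * ((1 + n\<^sup>2) / (1 - n\<^sup>2))" by simp
  have ge1: "1 \<le> (1 + n) / (1 - n)" using n by (simp add: divide_simps)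
  have pos: "0 < (1 + n\<^sup>2) / (1 - n\<^sup>2)" using n2 by (simp add: add_pos_nonneg)
  have "ln ((1 + n) / (1 - n)) \<le> ln (2 * ((1 + n\<^sup>2) / (1 - n\<^sup>2)))"
    using ge1 le by (intro ln_mono) auto
  also have "\<dots> = ln 2 + ln ((1 + n\<^sup>2) / (1 - n\<^sup>2))"
    using pos by (intro ln_mult_pos) auto
  finally have main: "ln ((1 + n) / (1 - n)) \<le> ln 2 + ln ((1 + n\<^sup>2) / (1 - n\<^sup>2))" .
  have "norm (hypvec z) \<le> \<bar>ln ((1 + n) / (1 - n))\<bar>"
    by (auto simp: hypvec_def norm_mult norm_divide n_def)
  also have "\<dots> = ln ((1 + n) / (1 - n))" using ge1 by simp
  finally show ?thesis using main by (simp add: n_def)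
qed

text \<open>Writing \<open>z / |z|\<close> and \<open>\<rho>\<close> in polar form, the derivatives of \<open>hypvec\<close> and of the frame component \<open>w\<close>
  have the same radial part, and their angular parts differ by a bounded factor.\<close>

lemma hypvec_has_derivative:
  fixes z :: "real \<Rightarrow> complex"
  assumes z': "(z has_vector_derivative w * of_real ((1 - (norm (z t))\<^sup>2) / 2)) (at t)"
    and nz: "z t \<noteq> 0" and lt: "norm (z t) < 1"
  shows "\<exists>h. ((\<lambda>t. hypvec (z t)) has_vector_derivative h) (at t) \<and>
    norm (h - w) \<le> \<bar>Im (cnj (z t) * w)\<bar> / norm (z t)"
proof -
  define n where "n = norm (z t)"
  define p where "p = Re (cnj (z t) * w)"
  define \<psi> where "\<psi> = Im (cnj (z t) * w)"
  define L where "L = ln ((1 + n) / (1 - n))"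
  \<comment> \<open>This is \<rho> / sinh \<rho>, the factor that the angular part of
    \<open>w\<close> acquires in the derivative of \<open>hypvec\<close>.\<close>
  define \<kappa> where "\<kappa> = (1 - n\<^sup>2) * L / (2 * n)"
  have n: "0 < n" "n < 1" using nz lt by (auto simp: n_def)
  have n2: "n\<^sup>2 < 1" using n by (simp add: power_less_one_iff)
  have dn2: "((\<lambda>t. (norm (z t))\<^sup>2) has_real_derivative p * (1 - n\<^sup>2)) (at t)"
    using norm_squared_has_derivative[OF z']
    by (rule DERIV_cong) (simp add: p_def n_def field_simps)
  have "((\<lambda>t. sqrt ((norm (z t))\<^sup>2)) has_real_derivative inverse (sqrt (n\<^sup>2)) / 2 * (p * (1 - n\<^sup>2))) (at t)"
    by (rule DERIV_chain2[OF DERIV_real_sqrt dn2[unfolded n_def], folded n_def]) (use n in auto)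
  then have dn: "((\<lambda>t. norm (z t)) has_real_derivative p * (1 - n\<^sup>2) / (2 * n)) (at t)"
    using n by (simp add: field_simps)
  have "((\<lambda>t. ln ((1 + norm (z t)) / (1 - norm (z t)))) has_real_derivative p / n) (at t)"
  proof -
    have "((\<lambda>t. ln ((1 + norm (z t)) / (1 - norm (z t)))) has_real_derivative
       (1 / ((1 + n) / (1 - n))) * ((p * (1 - n\<^sup>2) / (2 * n) * (1 - n) - (1 + n) * (- (p * (1 - n\<^sup>2) / (2 * n)))) / ((1 - n) * (1 - n)))) (at t)"
      using n by (auto intro!: derivative_eq_intros dn simp: n_def[symmetric])
    moreover have "(1 / ((1 + n) / (1 - n))) * ((p * (1 - n\<^sup>2) / (2 * n) * (1 - n) - (1 + n) * (- (p * (1 - n\<^sup>2) / (2 * n)))) / ((1 - n) * (1 - n))) = p / n"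
    proof -
      have "1 - n\<^sup>2 = (1 - n) * (1 + n)" by (simp add: power2_eq_square algebra_simps)
      then show ?thesis using n by (simp add: divide_simps) (simp add: algebra_simps)
    qed
    ultimately show ?thesis by simp
  qed
  from DERIV_divide[OF this dn] nz
  have "((\<lambda>t. ln ((1 + norm (z t)) / (1 - norm (z t))) / norm (z t)) has_real_derivative
     (p / n * n - L * (p * (1 - n\<^sup>2) / (2 * n))) / (n * n)) (at t)"
    by (simp add: n_def L_def)
  then have dq: "((\<lambda>t. ln ((1 + norm (z t)) / (1 - norm (z t))) / norm (z t)) has_real_derivative
     (p - \<kappa> * p) / n\<^sup>2) (at t)"
    by (rule DERIV_cong) (use n in \<open>simp add: \<kappa>_def field_simps power2_eq_square\<close>)
  define h where "h = z t * of_real ((p - \<kappa> * p) / n\<^sup>2) + w * of_real \<kappa>"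
  have "((\<lambda>t. z t * of_real (ln ((1 + norm (z t)) / (1 - norm (z t))) / norm (z t))) has_vector_derivative h) (at t)"
  proof -
    have e: "w * of_real ((1 - (norm (z t))\<^sup>2) / 2) * of_real (L / n) = w * of_real \<kappa>"
      using n by (simp add: \<kappa>_def n_def[symmetric])
    show ?thesis
      using has_vector_derivative_mult[OF z' has_vector_derivative_of_real[OF dq]]
      by (simp only: n_def[symmetric] L_def[symmetric] h_def e[unfolded n_def[symmetric]])
  qed
  moreover have "z t * of_real (ln ((1 + norm (z t)) / (1 - norm (z t))) / norm (z t)) = hypvec (z t)" for t
    by (auto simp: hypvec_def)
  ultimately have der: "((\<lambda>t. hypvec (z t)) has_vector_derivative h) (at t)" by simp
  have "z t * cnj (z t) = of_real (n\<^sup>2)" unfolding n_def by (simp only: complex_norm_square)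
  then have "w = z t * (cnj (z t) * w) / of_real (n\<^sup>2)" using n by (simp add: mult.assoc[symmetric])
  also have "cnj (z t) * w = of_real p + \<i> * of_real \<psi>"
    by (simp add: p_def \<psi>_def complex_eq_iff)
  finally have w: "w = z t * of_real (p / n\<^sup>2) + z t * (\<i> * of_real \<psi>) / of_real (n\<^sup>2)"
    by (simp add: algebra_simps add_divide_distrib)
  \<comment> \<open>The radial parts of \<open>h\<close> and \<open>w\<close> agree, so only the
    angular part remains, with the factor \<open>1 - \<kappa>\<close>.\<close>
  have "h - w = of_real (1 - \<kappa>) * (z t * of_real (p / n\<^sup>2) - w)"
    by (simp add: h_def algebra_simps diff_divide_distrib)
  also have "z t * of_real (p / n\<^sup>2) - w = - (z t * (\<i> * of_real \<psi>) / of_real (n\<^sup>2))"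
    by (subst w) simp
  finally have "norm (h - w) = \<bar>1 - \<kappa>\<bar> * (\<bar>\<psi>\<bar> / n)"
    using n by (simp add: norm_mult norm_divide n_def[symmetric] power2_eq_square del: of_real_diff of_real_power)
  \<comment> \<open>The crude range from 0 to 2 for \<open>\<kappa>\<close>, obtained from ln x
    \<le> x - 1, suffices.\<close>
  moreover have "\<bar>1 - \<kappa>\<bar> \<le> 1"
  proof -
    have "L \<le> (1 + n) / (1 - n) - 1" unfolding L_def using n by (intro ln_le_minus_one) auto
    also have "\<dots> = 2 * n / (1 - n)" using n by (simp add: field_simps)
    finally have "\<kappa> \<le> (1 - n\<^sup>2) * (2 * n / (1 - n)) / (2 * n)"
      unfolding \<kappa>_def using n n2 by (intro divide_right_mono mult_left_mono) auto
    also have "\<dots> = 1 + n" using n by (simp add: field_simps power2_eq_square)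
    finally have "\<kappa> \<le> 2" using n by simp
    moreover have "0 \<le> L" unfolding L_def using n by (intro ln_ge_zero) (simp add: divide_simps)
    then have "0 \<le> \<kappa>" using n n2 by (simp add: \<kappa>_def)
    ultimately show ?thesis by simp
  qed
  then have "\<bar>1 - \<kappa>\<bar> * (\<bar>\<psi>\<bar> / n) \<le> 1 * (\<bar>\<psi>\<bar> / n)"
    using n by (intro mult_right_mono) auto
  ultimately show ?thesis using der by (auto simp: \<psi>_def n_def)
qed

text \<open>Here \<open>w\<close> is the velocity in the orthonormal frame, \<open>f\<close> the
  covariant acceleration and \<open>M\<close> the limiting speed. As \<open>M\<close> may be
  arbitrarily small or zero, \<open>w_M\<close> controls the speed itself only through a square
  root, hence the separate bound \<open>w_le\<close>. The constants \<open>K1\<close> to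
  \<open>K7\<close> built from these data do not depend on \<open>M\<close>.\<close>

locale perturbed_geodesic =
  fixes \<beta> B t0 c0 M :: real and z w f :: "real \<Rightarrow> complex"
  assumes \<beta>: "0 < \<beta>" "\<beta> \<le> 1" and B: "1 \<le> B" and t0: "1 \<le> t0" and c0: "0 \<le> c0"
    and M: "0 \<le> M" "M \<le> 1"
    and z_deriv: "t \<ge> t0 \<Longrightarrow> (z has_vector_derivative w t * of_real ((1 - (norm (z t))\<^sup>2) / 2)) (at t)"
    and w_deriv: "t \<ge> t0 \<Longrightarrow>
      (w has_vector_derivative f t - \<i> * of_real (Im (cnj (z t) * w t)) * w t) (at t)"
    and disc: "norm (z t) < 1"
    and w_le_1: "t \<ge> t0 \<Longrightarrow> norm (w t) \<le> 1"
    and w_M: "t \<ge> t0 \<Longrightarrow> \<bar>(norm (w t))\<^sup>2 - M\<^sup>2\<bar> \<le> B * exp (- (\<beta> * t))"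
    and w_le: "t \<ge> t0 \<Longrightarrow> norm (w t) \<le> M + B * exp (- (\<beta> * t))"
    and f_le: "t \<ge> t0 \<Longrightarrow> norm (f t) \<le> B * exp (- (\<beta> * t))"
    and init: "ln ((1 + (norm (z t0))\<^sup>2) / (1 - (norm (z t0))\<^sup>2)) \<le> c0"
begin

text \<open>\<open>lnc\<close> is the logarithm of the hyperbolic cosine of the distance to the origin, and \<open>r\<close> is its derivative,
  which satisfies a Riccati equation.\<close>

definition "sq t = (norm (z t))\<^sup>2"
definition "p t = Re (cnj (z t) * w t)"
definition "\<psi> t = Im (cnj (z t) * w t)"
definition "lnc t = ln ((1 + sq t) / (1 - sq t))"
definition "r t = 2 * p t / (1 + sq t)"
text \<open>With \<rho> the distance to the origin, \<open>r\<close> is tanh \<rho> times the radial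
  speed. Away from the origin, \<open>\<nu>\<close> is thus the squared angular speed plus the
  squared radial speed divided by cosh^2 \<rho>.\<close>

definition "\<nu> t = (norm (w t))\<^sup>2 - (r t)\<^sup>2"
definition "err t = 2 * Re (cnj (z t) * f t) / (1 + sq t)"
definition "E t = B * exp (- (\<beta> * t))"

lemma sq: "0 \<le> sq t" "sq t < 1"
  using disc[of t] by (auto simp: sq_def power_less_one_iff)

lemma E_pos: "0 < E t"
  using B by (simp add: E_def)

lemma E_deriv: "(E has_real_derivative - (\<beta> * E t)) (at t)"
  unfolding E_def[abs_def] by (auto intro!: derivative_eq_intros)

lemma E_antimono: "s \<le> t \<Longrightarrow> E t \<le> E s"
  using \<beta> B by (simp add: E_def)

lemma p_psi: "(p t)\<^sup>2 + (\<psi> t)\<^sup>2 = sq t * (norm (w t))\<^sup>2"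
proof -
  have "(p t)\<^sup>2 + (\<psi> t)\<^sup>2 = (norm (cnj (z t) * w t))\<^sup>2"
    by (simp only: p_def \<psi>_def cmod_power2)
  then show ?thesis by (simp add: norm_mult power_mult_distrib sq_def)
qed

lemma sq_deriv:
  assumes "t \<ge> t0"
  shows "(sq has_real_derivative p t * (1 - sq t)) (at t)"
  using norm_squared_has_derivative[OF z_deriv[OF assms]] unfolding sq_def[abs_def]
  by (rule DERIV_cong) (simp add: p_def field_simps)

text \<open>The connection term of \<open>w_deriv\<close> contributes the square of
  \<open>\<psi>\<close>, which \<open>p_psi\<close> trades for a multiple of the squared speed minus
  the square of \<open>p\<close>.\<close>

lemma p_deriv:
  assumes "t \<ge> t0"
  shows "(p has_real_derivative
    (norm (w t))\<^sup>2 * (1 + sq t) / 2 - (p t)\<^sup>2 + Re (cnj (z t) * f t)) (at t)"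
proof -
  have "((\<lambda>t. Re (cnj (z t) * w t)) has_vector_derivative
     Re (cnj (z t) * (f t - \<i> * of_real (\<psi> t) * w t) + cnj (w t * of_real ((1 - sq t) / 2)) * w t)) (at t)"
    using bounded_linear.has_vector_derivative[OF bounded_linear_Re
      has_vector_derivative_mult[OF has_vector_derivative_cnj[OF z_deriv[OF assms]] w_deriv[OF assms]]]
    by (simp only: sq_def \<psi>_def)
  moreover have "cnj (w t * of_real ((1 - sq t) / 2)) * w t = of_real ((norm (w t))\<^sup>2 * (1 - sq t) / 2)"
    by (subst of_real_divide, subst of_real_mult, subst complex_norm_square) simp
  moreover have "Re (cnj (z t) * (f t - \<i> * of_real (\<psi> t) * w t)) = Re (cnj (z t) * f t) + (\<psi> t)\<^sup>2"
  proof -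
    have "cnj (z t) * (f t - \<i> * of_real (\<psi> t) * w t) = cnj (z t) * f t - \<i> * of_real (\<psi> t) * (cnj (z t) * w t)"
      by (simp add: algebra_simps)
    then have "Re (cnj (z t) * (f t - \<i> * of_real (\<psi> t) * w t))
      = Re (cnj (z t) * f t) - Re (\<i> * of_real (\<psi> t) * (cnj (z t) * w t))"
      by (simp only: minus_complex.sel)
    moreover have "Re (\<i> * of_real (\<psi> t) * q) = - \<psi> t * Im q" for q by simp
    ultimately show ?thesis by (simp only: \<psi>_def[symmetric]) (simp add: power2_eq_square)
  qed
  ultimately have "(p has_real_derivative
      Re (cnj (z t) * f t) + (\<psi> t)\<^sup>2 + (norm (w t))\<^sup>2 * (1 - sq t) / 2) (at t)"
    unfolding p_def[abs_def] has_real_derivative_iff_has_vector_derivative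
    by (simp only: plus_complex.sel Re_complex_of_real)
  then show ?thesis
    by (rule DERIV_cong) (use p_psi[of t] in \<open>simp add: field_simps\<close>)
qed

lemma r_deriv:
  assumes "t \<ge> t0"
  shows "(r has_real_derivative (norm (w t))\<^sup>2 - (r t)\<^sup>2 + err t) (at t)"
proof -
  have pos: "1 + sq t > 0" using sq[of t] by simp
  have der: "(r has_real_derivative
     (2 * ((norm (w t))\<^sup>2 * (1 + sq t) / 2 - (p t)\<^sup>2 + Re (cnj (z t) * f t)) * (1 + sq t)
      - 2 * p t * (p t * (1 - sq t))) / ((1 + sq t) * (1 + sq t))) (at t)"
    unfolding r_def[abs_def]
    by (rule derivative_eq_intros p_deriv[OF assms] sq_deriv[OF assms] refl)+ (use pos in auto)
  have alg: "(2 * (m * (1 + s) / 2 - q\<^sup>2 + g) * (1 + s) - 2 * q * (q * (1 - s))) / ((1 + s) * (1 + s))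
    = m - (2 * q / (1 + s))\<^sup>2 + 2 * g / (1 + s)" if "1 + s > 0" for m s q g :: real
    using that by (simp add: divide_simps power2_eq_square) (simp add: algebra_simps)
  show ?thesis
    using der by (rule DERIV_cong) (simp only: alg[OF pos] r_def err_def)
qed

lemma lnc_deriv:
  assumes "t \<ge> t0"
  shows "(lnc has_real_derivative r t) (at t)"
proof -
  have "(lnc has_real_derivative
     (1 / ((1 + sq t) / (1 - sq t))) * ((p t * (1 - sq t) * (1 - sq t) - (1 + sq t) * (- (p t * (1 - sq t)))) / ((1 - sq t) * (1 - sq t)))) (at t)"
    unfolding lnc_def[abs_def] using sq[of t]
    by (auto intro!: derivative_eq_intros sq_deriv[OF assms] divide_pos_pos simp: add_pos_nonneg)
  then show ?thesis
    by (rule DERIV_cong) (use sq[of t] in \<open>simp add: r_def divide_simps, simp add: algebra_simps\<close>)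
qed

lemma lnc_nonneg: "0 \<le> lnc t"
  unfolding lnc_def using sq[of t] by (intro ln_ge_zero) (simp add: divide_simps)

text \<open>The difference of the two sides is the square of
  \<open>p t * (1 - sq t) / (1 + sq t)\<close>.\<close>

lemma psi_sq_le: "(\<psi> t)\<^sup>2 \<le> sq t * \<nu> t"
proof -
  have pos: "1 + sq t > 0" using sq[of t] by simp
  have "sq t * \<nu> t - (\<psi> t)\<^sup>2 = (p t)\<^sup>2 - sq t * (r t)\<^sup>2"
    using p_psi[of t] by (simp add: \<nu>_def algebra_simps)
  also have "\<dots> = (p t * (1 - sq t) / (1 + sq t))\<^sup>2"
    using pos by (simp add: r_def divide_simps power2_eq_square) (simp add: algebra_simps)
  finally show ?thesis by (smt (verit) zero_le_power2)
qed

lemma r_sq_le: "(r t)\<^sup>2 \<le> (norm (w t))\<^sup>2"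
proof -
  have pos: "1 + sq t > 0" using sq[of t] by simp
  have "(p t)\<^sup>2 \<le> sq t * (norm (w t))\<^sup>2" using p_psi[of t] by (smt (verit) zero_le_power2)
  moreover have "4 * sq t \<le> (1 + sq t)\<^sup>2"
    using zero_le_power2[of "1 - sq t"] by (simp add: power2_eq_square algebra_simps)
  then have "4 * (sq t * (norm (w t))\<^sup>2) \<le> (1 + sq t)\<^sup>2 * (norm (w t))\<^sup>2"
    using mult_right_mono[of "4 * sq t" "(1 + sq t)\<^sup>2" "(norm (w t))\<^sup>2"] by simp
  ultimately have "4 * (p t)\<^sup>2 \<le> (norm (w t))\<^sup>2 * (1 + sq t)\<^sup>2" by (simp add: mult.commute)
  then show ?thesis
    using pos by (simp add: r_def power_divide power_mult_distrib pos_divide_le_eq)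
qed

lemma nu_nonneg: "0 \<le> \<nu> t"
  using r_sq_le[of t] by (simp add: \<nu>_def)

lemma abs_r_le: "\<bar>r t\<bar> \<le> norm (w t)"
  using r_sq_le[of t] power2_le_imp_le[of "\<bar>r t\<bar>" "norm (w t)"] by simp

lemma sqrt_nu_le: "sqrt (\<nu> t) \<le> norm (w t)"
  by (rule real_le_lsqrt) (simp_all add: \<nu>_def)

text \<open>The factor \<open>norm (z t)\<close> is kept because it cancels the denominator in
  \<open>hypvec_has_derivative\<close>.\<close>

lemma abs_psi_le: "\<bar>\<psi> t\<bar> \<le> sqrt (\<nu> t) * norm (z t)"
proof -
  have "\<bar>\<psi> t\<bar> = sqrt ((\<psi> t)\<^sup>2)" by simp
  also have "\<dots> \<le> sqrt (sq t * \<nu> t)" using psi_sq_le by (rule real_sqrt_le_mono)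
  also have "\<dots> = sqrt (\<nu> t) * norm (z t)" by (simp add: real_sqrt_mult sq_def)
  finally show ?thesis .
qed

lemma abs_psi_le': "\<bar>\<psi> t\<bar> \<le> sqrt (\<nu> t)"
  using abs_psi_le[of t] disc[of t] nu_nonneg[of t]
  by (smt (verit) mult_left_le real_sqrt_ge_zero norm_ge_zero)

lemma err_le:
  assumes "t \<ge> t0"
  shows "\<bar>err t\<bar> \<le> E t"
proof -
  have pos: "1 + sq t > 0" using sq[of t] by simp
  have "2 * norm (z t) \<le> 1 + sq t"
    using zero_le_power2[of "1 - norm (z t)"] by (simp add: sq_def power2_eq_square algebra_simps)
  moreover have "\<bar>Re (cnj (z t) * f t)\<bar> \<le> norm (z t) * norm (f t)"
    using abs_Re_le_cmod[of "cnj (z t) * f t"] by (simp add: norm_mult)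
  ultimately have "2 * \<bar>Re (cnj (z t) * f t)\<bar> \<le> (1 + sq t) * norm (f t)"
    using mult_right_mono[of "2 * norm (z t)" "1 + sq t" "norm (f t)"] by simp
  then have "\<bar>err t\<bar> \<le> norm (f t)"
    by (simp only: err_def abs_divide abs_mult abs_numeral abs_of_pos[OF pos] pos_divide_le_eq[OF pos] mult.commute)
  then show ?thesis using f_le[OF assms] by (simp add: E_def)
qed

lemma w_sq_deriv:
  assumes "t \<ge> t0"
  shows "((\<lambda>t. (norm (w t))\<^sup>2) has_real_derivative 2 * Re (cnj (w t) * f t)) (at t)"
proof -
  have "cnj (w t) * (f t - \<i> * of_real (Im (cnj (z t) * w t)) * w t)
     = cnj (w t) * f t - \<i> * of_real (Im (cnj (z t) * w t)) * (w t * cnj (w t))"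
    by (simp add: algebra_simps)
  also have "\<dots> = cnj (w t) * f t - \<i> * of_real (Im (cnj (z t) * w t)) * of_real ((norm (w t))\<^sup>2)"
    by (simp only: complex_norm_square)
  finally have "Re (cnj (w t) * (f t - \<i> * of_real (Im (cnj (z t) * w t)) * w t))
    = Re (cnj (w t) * f t - \<i> * of_real (Im (cnj (z t) * w t)) * of_real ((norm (w t))\<^sup>2))"
    by (rule arg_cong)
  also have "\<dots> = Re (cnj (w t) * f t)"
    unfolding minus_complex.sel by (simp add: mult.assoc flip: of_real_mult)
  finally have *: "Re (cnj (w t) * (f t - \<i> * of_real (Im (cnj (z t) * w t)) * w t)) = Re (cnj (w t) * f t)" .
  show ?thesis
    using norm_squared_has_derivative[OF w_deriv[OF assms]] unfolding * .
qed

lemma nu_deriv: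
  assumes "t \<ge> t0"
  shows "(\<nu> has_real_derivative 2 * Re (cnj (w t) * f t) - 2 * r t * (\<nu> t + err t)) (at t)"
  unfolding \<nu>_def[abs_def]
  by (rule derivative_eq_intros w_sq_deriv[OF assms] r_deriv[OF assms] refl)+ (simp add: \<nu>_def algebra_simps)

text \<open>The term with \<open>r t * \<nu> t\<close> acts as damping once \<open>r\<close> is
  positive. Since the speed is at most 1, the two terms with \<open>f\<close> and \<open>err\<close>
  cost at most \<open>2 * E t\<close> each.\<close>

lemma nu_deriv_le:
  assumes "t \<ge> t0"
  shows "2 * Re (cnj (w t) * f t) - 2 * r t * (\<nu> t + err t) \<le> - 2 * r t * \<nu> t + 4 * E t"
proof -
  have "Re (cnj (w t) * f t) \<le> norm (w t) * norm (f t)"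
    using complex_Re_le_cmod[of "cnj (w t) * f t"] by (simp add: norm_mult)
  also have "\<dots> \<le> 1 * E t"
    using w_le_1[OF assms] f_le[OF assms] by (intro mult_mono) (auto simp: E_def)
  finally have 1: "Re (cnj (w t) * f t) \<le> E t" by simp
  have "- (r t * err t) \<le> \<bar>r t\<bar> * \<bar>err t\<bar>" by (metis abs_ge_minus_self abs_mult)
  also have "\<dots> \<le> 1 * E t"
    using abs_r_le[of t] w_le_1[OF assms] err_le[OF assms] by (intro mult_mono) auto
  finally have "- (r t * err t) \<le> E t" by simp
  then show ?thesis using 1 by (simp add: algebra_simps)
qed

lemma lnc_le:
  assumes "t \<ge> t0"
  shows "lnc t \<le> c0 + B / \<beta> + M * t"
proof -
  \<comment> \<open>The term \<open>E t / \<beta>\<close> compensates the integrated excess of the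
    speed over \<open>M\<close>.\<close>
  define g where "g t = lnc t - M * t + E t / \<beta>" for t
  have "g t \<le> g t0"
  proof (rule DERIV_nonpos_le[OF assms])
    fix x assume x: "t0 \<le> x" "x \<le> t"
    have "(g has_real_derivative r x - M - E x) (at x)"
      unfolding g_def[abs_def]
      by (rule derivative_eq_intros lnc_deriv[OF x(1)] E_deriv refl)+ (use \<beta> in auto)
    moreover have "r x - M - E x \<le> 0"
      using abs_r_le[of x] w_le[OF x(1)] by (simp add: E_def)
    ultimately show "\<exists>y. (g has_real_derivative y) (at x) \<and> y \<le> 0" by blast
  qed
  moreover have "E t0 / \<beta> \<le> B / \<beta>"
    using \<beta> B t0 by (intro divide_right_mono) (auto simp: E_def mult_le_cancel_left1)
  moreover have "0 \<le> E t / \<beta>" using E_pos[of t] \<beta> by simp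
  moreover have "0 \<le> M * t0" using M t0 by simp
  moreover have "lnc t0 \<le> c0" using init by (simp add: lnc_def sq_def)
  ultimately show ?thesis unfolding g_def by linarith
qed

text \<open>From \<open>t1\<close> on the errors are at most \<open>M^2/16\<close>; before \<open>t2\<close> the function \<open>r\<close> has entered the region
  \<open>r > M/2\<close>. The bound \<open>M * t2 \<le> K3\<close> with \<open>K3\<close> independent of \<open>M\<close> makes all later constants uniform;
  \<open>t1\<close> and \<open>t2\<close> are meaningful only for \<open>M > 0\<close>.\<close>

definition "K1 = t0 + (ln (16 * B) + 2) / \<beta>"
definition "K2 = c0 + K1 + B / \<beta>"
definition "K3 = K1 + 2 * (K2 + 1) + 4"
definition "t1 = t0 + ln (16 * B / M\<^sup>2) / \<beta>"
definition "t2 = t1 + (2 * (K2 + 1) + 4) / M"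

lemma K_nonneg: "0 \<le> K1" "0 \<le> K2" "0 \<le> K3"
proof -
  have "0 \<le> ln (16 * B)" using B by (intro ln_ge_zero) simp
  then show "0 \<le> K1" using \<beta> t0 by (simp add: K1_def)
  then show "0 \<le> K2" using \<beta> B c0 by (simp add: K2_def)
  then show "0 \<le> K3" using \<open>0 \<le> K1\<close> by (simp add: K3_def)
qed

lemma t1_ge: "M > 0 \<Longrightarrow> t1 \<ge> t0"
proof -
  assume "M > 0"
  then have "M\<^sup>2 \<le> 1" "M\<^sup>2 > 0" using M by (auto simp: power_le_one)
  then have "1 \<le> 16 * B / M\<^sup>2" using B by (simp add: divide_simps)
  then show ?thesis using \<beta> by (simp add: t1_def)
qed

lemma t2_ge: "M > 0 \<Longrightarrow> t2 \<ge> t1"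
  using K_nonneg by (simp add: t2_def)

lemma E_t1: assumes "M > 0" "t \<ge> t1" shows "E t \<le> M\<^sup>2 / 16"
proof -
  have pos: "16 * B / M\<^sup>2 > 0" using assms B by simp
  have "E t \<le> E t1" by (rule E_antimono[OF assms(2)])
  also have "\<dots> = B * (exp (- (\<beta> * t0)) * exp (- ln (16 * B / M\<^sup>2)))"
    using \<beta> by (simp add: E_def t1_def algebra_simps exp_add[symmetric])
  also have "exp (- ln (16 * B / M\<^sup>2)) = M\<^sup>2 / (16 * B)"
    using pos by (subst exp_minus, subst exp_ln) (auto simp: field_simps)
  also have "B * (exp (- (\<beta> * t0)) * (M\<^sup>2 / (16 * B))) = exp (- (\<beta> * t0)) * (M\<^sup>2 / 16)"
    using B by (simp add: field_simps)
  also have "\<dots> \<le> 1 * (M\<^sup>2 / 16)"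
    using \<beta> t0 by (intro mult_right_mono) auto
  finally show ?thesis by simp
qed

text \<open>Although \<open>t1\<close> diverges logarithmically as \<open>M\<close> tends to 0, the
  product \<open>M * ln (1 / M)\<close> stays below 1.\<close>

lemma M_t1: assumes "M > 0" shows "M * t1 \<le> K1"
proof -
  have "M * ln (1 / M) \<le> M * (1 / M - 1)"
    using assms by (intro mult_left_mono ln_le_minus_one) auto
  then have 1: "M * ln (1 / M) \<le> 1" using assms by (simp add: algebra_simps)
  have "ln (16 * B / M\<^sup>2) = ln (16 * B) - ln (M\<^sup>2)"
    using assms B by (intro ln_divide_pos) auto
  also have "ln (M\<^sup>2) = - 2 * ln (1 / M)"
    using assms by (simp add: ln_realpow ln_div)
  finally have "ln (16 * B / M\<^sup>2) = ln (16 * B) + 2 * ln (1 / M)" by simp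
  then have "M * ln (16 * B / M\<^sup>2) = M * ln (16 * B) + 2 * (M * ln (1 / M))"
    by (simp add: algebra_simps)
  also have "M * ln (16 * B) \<le> 1 * ln (16 * B)"
    using M B by (intro mult_right_mono ln_ge_zero) auto
  finally have "M * ln (16 * B / M\<^sup>2) \<le> ln (16 * B) + 2" using 1 by simp
  then have "(M * ln (16 * B / M\<^sup>2)) / \<beta> \<le> (ln (16 * B) + 2) / \<beta>"
    using \<beta> by (intro divide_right_mono) auto
  moreover have "M * t0 \<le> 1 * t0" using M t0 by (intro mult_right_mono) auto
  ultimately show ?thesis by (simp add: t1_def K1_def algebra_simps)
qed

lemma M_t2: assumes "M > 0" shows "M * t2 \<le> K3"
proof -
  have "M * ((2 * (K2 + 1) + 4) / M) = 2 * (K2 + 1) + 4" using assms by simp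
  then show ?thesis
    using M_t1[OF assms] unfolding t2_def K3_def distrib_left by linarith
qed

section \<open>Entry into the stable region \<open>r > M / 2\<close>\<close>

lemma err_ge: assumes "M > 0" "t \<ge> t1" shows "(norm (w t))\<^sup>2 + err t \<ge> 7 / 8 * M\<^sup>2"
proof -
  have "t \<ge> t0" using assms t1_ge by simp
  then show ?thesis
    \<comment> \<open>Two errors of at most M^2/16 each leave the factor 7/8.\<close>
    using w_M[of t, folded E_def] err_le[of t] E_t1[OF assms] by linarith
qed

text \<open>Otherwise \<open>lnc\<close>, which is at most \<open>K2\<close> at \<open>t1\<close>,
  would drop by at least \<open>K2 + 1\<close> over this interval and become negative.\<close>

lemma r_exceeds_once:
  assumes "M > 0"
  shows "\<exists>s\<in>{t1..t1 + 2 * (K2 + 1) / M}. r s > - M / 2"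
proof (rule ccontr)
  assume "\<not> ?thesis"
  then have le: "r s \<le> - M / 2" if "t1 \<le> s" "s \<le> t1 + 2 * (K2 + 1) / M" for s
    using that by force
  define g where "g t = lnc t + M / 2 * t" for t
  have ge: "t1 \<le> t1 + 2 * (K2 + 1) / M" using assms K_nonneg by simp
  have g: "g (t1 + 2 * (K2 + 1) / M) \<le> g t1"
  proof (rule DERIV_nonpos_le[OF ge])
    fix x assume x: "t1 \<le> x" "x \<le> t1 + 2 * (K2 + 1) / M"
    have "t0 \<le> x" using x t1_ge[OF assms] by simp
    then have "(g has_real_derivative r x + M / 2) (at x)"
      unfolding g_def[abs_def] by (auto intro!: derivative_eq_intros lnc_deriv)
    then show "\<exists>y. (g has_real_derivative y) (at x) \<and> y \<le> 0" using le[OF x] by force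
  qed
  have "lnc (t1 + 2 * (K2 + 1) / M) + (K2 + 1) \<le> lnc t1"
  proof -
    have "M / 2 * (2 * (K2 + 1) / M) = K2 + 1" using assms by (simp add: field_simps)
    then show ?thesis using g unfolding g_def distrib_left by linarith
  qed
  moreover have "lnc t1 \<le> K2"
    using lnc_le[OF t1_ge[OF assms]] M_t1[OF assms] by (simp add: K2_def)
  ultimately show False using lnc_nonneg[of "t1 + 2 * (K2 + 1) / M"] by linarith
qed

lemma r_ge_half:
  assumes "M > 0" "t \<ge> t2"
  shows "r t > M / 2"
proof -
  obtain s where s: "t1 \<le> s" "s \<le> t1 + 2 * (K2 + 1) / M" "r s > - M / 2"
    using r_exceeds_once[OF assms(1)] by auto
  have t2: "s + 4 / M \<le> t2" using s by (simp add: t2_def add_divide_distrib)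
  have M2: "M\<^sup>2 > 0" using assms(1) by simp
  \<comment> \<open>In the strip where \<open>\<bar>r x\<bar> \<le> M / 2\<close> the square of
    \<open>r\<close> costs at most M^2/4, and 7/8 - 1/4 = 5/8.\<close>
  have grow: "(norm (w x))\<^sup>2 - (r x)\<^sup>2 + err x \<ge> 5 / 8 * M\<^sup>2" if "s \<le> x" "\<bar>r x\<bar> \<le> M / 2" for x
  proof -
    have "(r x)\<^sup>2 \<le> (M / 2)\<^sup>2" using that(2) power_mono[of "\<bar>r x\<bar>" "M / 2" 2] by simp
    then have "(r x)\<^sup>2 \<le> M\<^sup>2 / 4" by (simp add: power_divide)
    then show ?thesis using err_ge[OF assms(1), of x] that s by linarith
  qed
  \<comment> \<open>The comparison line starts at -M/2 and rises with slope M^2/4, below the growth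
    rate of \<open>r\<close> in the strip; it reaches M/2 after time 4/M.\<close>
  have "r (s + 4 / M) - (- M / 2 + M\<^sup>2 / 4 * (s + 4 / M - s)) > 0"
  proof (rule barrier[where a = s and b = "s + 4 / M" and
        d = "\<lambda>x. r x - (- M / 2 + M\<^sup>2 / 4 * (x - s))" and
        d' = "\<lambda>x. (norm (w x))\<^sup>2 - (r x)\<^sup>2 + err x - M\<^sup>2 / 4"])
    fix x assume x: "s \<le> x" "x \<le> s + 4 / M"
    have "t0 \<le> x" using x s t1_ge[OF assms(1)] by simp
    then show "((\<lambda>x. r x - (- M / 2 + M\<^sup>2 / 4 * (x - s))) has_real_derivative
        (norm (w x))\<^sup>2 - (r x)\<^sup>2 + err x - M\<^sup>2 / 4) (at x)"
      by (auto intro!: derivative_eq_intros r_deriv)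
    assume "r x - (- M / 2 + M\<^sup>2 / 4 * (x - s)) = 0"
    moreover have "M\<^sup>2 / 4 * (x - s) \<le> M\<^sup>2 / 4 * (4 / M)" using x by (intro mult_left_mono) auto
    then have "M\<^sup>2 / 4 * (x - s) \<le> M" using assms(1) by (simp add: power2_eq_square)
    moreover have "0 \<le> M\<^sup>2 / 4 * (x - s)" using x by simp
    ultimately have "\<bar>r x\<bar> \<le> M / 2" by linarith
    then show "0 < (norm (w x))\<^sup>2 - (r x)\<^sup>2 + err x - M\<^sup>2 / 4"
      using grow[OF x(1)] M2 by linarith
  qed (use s assms in auto)
  moreover have "M\<^sup>2 / 4 * (s + 4 / M - s) = M" using assms(1) by (simp add: power2_eq_square)
  ultimately have start: "r (s + 4 / M) - M / 2 > 0" by simp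
  \<comment> \<open>From here on the constant M/2 is itself a lower barrier.\<close>
  have "r t - M / 2 > 0"
  proof (rule barrier[where a = "s + 4 / M" and b = t and d = "\<lambda>x. r x - M / 2" and
        d' = "\<lambda>x. (norm (w x))\<^sup>2 - (r x)\<^sup>2 + err x", OF _ start])
    fix x assume x: "s + 4 / M \<le> x" "x \<le> t"
    have sx: "s \<le> x" using x(1) assms(1) by (smt (verit) divide_pos_pos)
    then have "t0 \<le> x" using s t1_ge[OF assms(1)] by simp
    then show "((\<lambda>x. r x - M / 2) has_real_derivative (norm (w x))\<^sup>2 - (r x)\<^sup>2 + err x) (at x)"
      by (auto intro!: derivative_eq_intros r_deriv)
    assume "r x - M / 2 = 0"
    then have "\<bar>r x\<bar> \<le> M / 2" using assms(1) by simp
    then show "0 < (norm (w x))\<^sup>2 - (r x)\<^sup>2 + err x"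
      using grow[OF sx] M2 by linarith
  qed (use t2 assms in auto)
  then show ?thesis by simp
qed

section \<open>Decay of the angular speed\<close>

definition "\<sigma> = \<beta> / 4"
definition "K4 = exp K3 * (2 + 1 / (2 * \<beta>))"
definition "K5 = sqrt K4 + exp K3"

lemma sigma: "0 < \<sigma>" "\<sigma> \<le> 1"
  using \<beta> by (auto simp: \<sigma>_def)

lemma K5_nonneg: "0 \<le> K5"
  using \<beta> by (simp add: K5_def K4_def)

lemma nu_decay:
  assumes "M > 0" "t \<ge> t2"
  shows "\<nu> t \<le> K4 * M\<^sup>2 * exp (- (2 * \<sigma> * M * t))"
proof -
  \<comment> \<open>A rate below the damping rate \<open>M\<close> that also leaves
    \<open>\<beta> - \<eta> \<ge> \<beta> / 2\<close>, so that the weighted forcing still decays. It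
    equals \<open>2 * \<sigma> * M\<close>, hence the square root of \<open>\<nu>\<close> decays
    with rate \<open>\<sigma> * M\<close>.\<close>
  define \<eta> where "\<eta> = \<beta> * M / 2"
  have \<eta>: "0 < \<eta>" "\<eta> \<le> M" "\<eta> \<le> \<beta> / 2"
    using \<beta> M assms(1) by (auto simp: \<eta>_def mult_le_cancel_left1 mult_le_cancel_right1 divide_le_eq)
  define D where "D = 8 * B / \<beta>"
  have D: "4 * B \<le> D * (\<beta> - \<eta>)"
  proof -
    have "4 * B = D * (\<beta> / 2)" using \<beta> by (simp add: D_def)
    also have "\<dots> \<le> D * (\<beta> - \<eta>)"
      using \<eta> \<beta> B by (intro mult_left_mono) (auto simp: D_def)
    finally show ?thesis .
  qed
  \<comment> \<open>The second term absorbs the forcing \<open>4 * E\<close>, by the choice of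
    \<open>D\<close>, and makes \<open>g\<close> nonincreasing.\<close>
  define g where "g x = exp (\<eta> * x) * \<nu> x + D * exp (- ((\<beta> - \<eta>) * x))" for x
  have "g t \<le> g t2"
  proof (rule DERIV_nonpos_le[OF assms(2)])
    fix x assume x: "t2 \<le> x" "x \<le> t"
    have x0: "t0 \<le> x" using x t1_ge[OF assms(1)] t2_ge[OF assms(1)] by simp
    let ?n = "2 * Re (cnj (w x) * f x) - 2 * r x * (\<nu> x + err x)"
    have der: "(g has_real_derivative (exp (\<eta> * x) * ?n + \<eta> * exp (\<eta> * x) * \<nu> x
        - (\<beta> - \<eta>) * (D * exp (- ((\<beta> - \<eta>) * x))))) (at x)"
      unfolding g_def[abs_def]
      by (rule derivative_eq_intros nu_deriv[OF x0] refl)+ (simp add: algebra_simps)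
    have "M * \<nu> x \<le> 2 * r x * \<nu> x"
      using r_ge_half[OF assms(1) x(1)] nu_nonneg[of x] by (intro mult_right_mono) auto
    moreover have "\<eta> * \<nu> x \<le> M * \<nu> x" using \<eta> nu_nonneg[of x] by (intro mult_right_mono)
    ultimately have "?n + \<eta> * \<nu> x \<le> 4 * E x" using nu_deriv_le[OF x0] by linarith
    then have "exp (\<eta> * x) * (?n + \<eta> * \<nu> x) \<le> exp (\<eta> * x) * (4 * E x)"
      by (rule mult_left_mono) simp
    also have "\<dots> = 4 * B * exp (- ((\<beta> - \<eta>) * x))"
      by (simp add: E_def exp_add[symmetric] algebra_simps)
    also have "\<dots> \<le> D * (\<beta> - \<eta>) * exp (- ((\<beta> - \<eta>) * x))"
      using D by (rule mult_right_mono) simp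
    finally have "exp (\<eta> * x) * ?n + \<eta> * exp (\<eta> * x) * \<nu> x - (\<beta> - \<eta>) * (D * exp (- ((\<beta> - \<eta>) * x))) \<le> 0"
      by (simp only: distrib_left mult.commute mult.left_commute mult.assoc)
    then show "\<exists>y. (g has_real_derivative y) (at x) \<and> y \<le> 0" using der by blast
  qed
  moreover have "0 \<le> D * exp (- ((\<beta> - \<eta>) * t))" using B \<beta> by (simp add: D_def)
  ultimately have "exp (\<eta> * t) * \<nu> t \<le> exp (\<eta> * t2) * \<nu> t2 + D * exp (- ((\<beta> - \<eta>) * t2))"
    by (simp add: g_def)
  also have "\<dots> = exp (\<eta> * t2) * (\<nu> t2 + D * exp (- (\<beta> * t2)))"
    by (simp add: distrib_left exp_add[symmetric] algebra_simps)
  \<comment> \<open>Uniformity in \<open>M\<close> enters here: at \<open>t2\<close> both summands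
    are bounded by multiples of M^2, and \<open>\<eta> * t2 \<le> M * t2 \<le> K3\<close>.\<close>
  also have "\<dots> \<le> exp K3 * (M\<^sup>2 * (2 + 1 / (2 * \<beta>)))"
  proof (rule mult_mono)
    have t20: "t0 \<le> t2" using t1_ge[OF assms(1)] t2_ge[OF assms(1)] by simp
    have E2: "E t2 \<le> M\<^sup>2 / 16" by (rule E_t1[OF assms(1) t2_ge[OF assms(1)]])
    have "\<nu> t2 \<le> (norm (w t2))\<^sup>2" by (simp add: \<nu>_def)
    also have "\<dots> \<le> M\<^sup>2 + E t2" using w_M[OF t20] by (simp add: E_def)
    also have "\<dots> \<le> 2 * M\<^sup>2" using E2 zero_le_power2[of M] by linarith
    finally have 1: "\<nu> t2 \<le> 2 * M\<^sup>2" .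
    have "D * exp (- (\<beta> * t2)) = 8 / \<beta> * E t2" by (simp add: D_def E_def)
    also have "\<dots> \<le> 8 / \<beta> * (M\<^sup>2 / 16)" using E2 \<beta> by (intro mult_left_mono) auto
    finally show "\<nu> t2 + D * exp (- (\<beta> * t2)) \<le> M\<^sup>2 * (2 + 1 / (2 * \<beta>))"
      using 1 by (simp add: algebra_simps)
    have "\<eta> * t2 = \<beta> / 2 * (M * t2)" by (simp add: \<eta>_def)
    also have "\<dots> \<le> 1 * K3"
      using \<beta> M_t2[OF assms(1)] M t20 t0 by (intro mult_mono) auto
    finally show "exp (\<eta> * t2) \<le> exp K3" by simp
    show "0 \<le> \<nu> t2 + D * exp (- (\<beta> * t2))" using nu_nonneg[of t2] B \<beta> by (simp add: D_def)
  qed simp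
  finally have "exp (\<eta> * t) * \<nu> t \<le> K4 * M\<^sup>2" by (simp add: K4_def algebra_simps)
  then have "\<nu> t \<le> K4 * M\<^sup>2 * exp (- (\<eta> * t))"
    by (simp add: exp_minus field_simps)
  moreover have "2 * \<sigma> * M * t = \<eta> * t" by (simp add: \<sigma>_def \<eta>_def)
  ultimately show ?thesis by (simp only:)
qed

text \<open>After \<open>t2\<close> this is the root of \<open>nu_decay\<close>. Up to
  \<open>t2\<close> the bound by the speed suffices, because \<open>M * t \<le> K3\<close> keeps the
  exponential away from 0; for \<open>M = 0\<close> the speed is at most \<open>E t\<close>.\<close>

lemma sqrt_nu_decay:
  assumes "t \<ge> t0"
  shows "sqrt (\<nu> t) \<le> K5 * M * exp (- (\<sigma> * M * t)) + E t"
proof (cases "M > 0 \<and> t \<ge> t2")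
  case True
  have "sqrt (\<nu> t) \<le> sqrt (K4 * M\<^sup>2 * exp (- (2 * \<sigma> * M * t)))"
    using nu_decay True by (intro real_sqrt_le_mono) auto
  also have "exp (- (2 * \<sigma> * M * t)) = (exp (- (\<sigma> * M * t)))\<^sup>2"
    by (simp add: exp_double[symmetric] algebra_simps)
  also have "sqrt (K4 * M\<^sup>2 * (exp (- (\<sigma> * M * t)))\<^sup>2) = sqrt K4 * (M * exp (- (\<sigma> * M * t)))"
    using M by (simp add: real_sqrt_mult)
  also have "\<dots> \<le> K5 * (M * exp (- (\<sigma> * M * t)))"
    using M by (intro mult_right_mono) (auto simp: K5_def)
  finally show ?thesis using E_pos[of t] by (simp add: mult.assoc)
next
  case False
  have "M \<le> K5 * M * exp (- (\<sigma> * M * t))"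
  proof (cases "M = 0")
    case False
    then have "M > 0" "t \<le> t2" using \<open>\<not> (M > 0 \<and> t \<ge> t2)\<close> M by auto
    then have "M * t \<le> M * t2" by (intro mult_left_mono) auto
    then have "M * t \<le> K3" using M_t2[OF \<open>M > 0\<close>] by linarith
    then have "\<sigma> * (M * t) \<le> 1 * K3"
      using sigma M assms t0 by (intro mult_mono) auto
    then have "1 \<le> exp (K3 - \<sigma> * M * t)" by (simp add: mult.assoc)
    also have "\<dots> = exp K3 * exp (- (\<sigma> * M * t))" by (simp add: exp_add[symmetric])
    also have "\<dots> \<le> K5 * exp (- (\<sigma> * M * t))"
      using \<beta> by (intro mult_right_mono) (auto simp: K5_def K4_def)
    finally have "M * 1 \<le> M * (K5 * exp (- (\<sigma> * M * t)))" using M by (intro mult_left_mono)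
    then show ?thesis by (simp add: algebra_simps)
  qed simp
  then show ?thesis
    using sqrt_nu_le[of t] w_le[OF assms] by (simp add: E_def)
qed

section \<open>Convergence of the velocity\<close>

definition "\<Phi> t = K5 / \<sigma> * M * exp (- (\<sigma> * M * t)) + 3 / \<beta> * E t"

text \<open>\<open>\<Phi> t\<close> is the integral over all later times of the bound on the
  derivative of \<open>w\<close>; integrating the exponential of rate \<open>\<sigma> * M\<close>
  consumes one of the two factors \<open>M\<close>.\<close>

lemma Phi_deriv: "(\<Phi> has_real_derivative - (K5 * M\<^sup>2 * exp (- (\<sigma> * M * t)) + 3 * E t)) (at t)"
  unfolding \<Phi>_def[abs_def]
  by (rule derivative_eq_intros E_deriv refl)+
    (use sigma \<beta> in \<open>simp add: power2_eq_square\<close>)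

lemma Phi_nonneg: "0 \<le> \<Phi> t"
  using K5_nonneg sigma M \<beta> E_pos[of t] by (simp add: \<Phi>_def)

text \<open>The rotation term is at most the root of \<open>\<nu>\<close> times the speed; each of
  them contributes one factor \<open>M\<close>.\<close>

lemma norm_w_deriv_le:
  assumes "t \<ge> t0"
  shows "norm (f t - \<i> * of_real (Im (cnj (z t) * w t)) * w t)
    \<le> K5 * M\<^sup>2 * exp (- (\<sigma> * M * t)) + 3 * E t"
proof -
  have "norm (f t - \<i> * of_real (Im (cnj (z t) * w t)) * w t)
     \<le> norm (f t) + norm (\<i> * of_real (Im (cnj (z t) * w t)) * w t)"
    by (rule norm_triangle_ineq4)
  also have "\<dots> = norm (f t) + \<bar>\<psi> t\<bar> * norm (w t)"
    unfolding \<psi>_def[symmetric] by (simp add: norm_mult)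
  also have "\<dots> \<le> E t + sqrt (\<nu> t) * (M + E t)"
    using f_le[OF assms] w_le[OF assms] abs_psi_le'[of t]
    by (intro add_mono mult_mono) (auto simp: E_def nu_nonneg)
  also have "\<dots> = E t + (sqrt (\<nu> t) * M + sqrt (\<nu> t) * E t)" by (simp add: algebra_simps)
  also have "\<dots> \<le> E t + ((K5 * M * exp (- (\<sigma> * M * t)) + E t) * M + 1 * E t)"
    using sqrt_nu_decay[OF assms] order_trans[OF sqrt_nu_le[of t] w_le_1[OF assms]] M(1) less_imp_le[OF E_pos[of t]]
    by (intro add_left_mono add_mono mult_right_mono)
  also have "\<dots> \<le> K5 * M\<^sup>2 * exp (- (\<sigma> * M * t)) + 3 * E t"
    using mult_left_mono[OF M(2), of "E t"] E_pos[of t] by (simp add: algebra_simps power2_eq_square)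
  finally show ?thesis .
qed

lemma w_diff_le:
  assumes "t0 \<le> t" "t \<le> s"
  shows "norm (w s - w t) \<le> \<Phi> t"
proof (cases "t = s")
  case False
  have "norm (w s - w t) \<le> (- \<Phi> s) - (- \<Phi> t)"
  proof (rule differentiable_bound_general[where
        f' = "\<lambda>x. f x - \<i> * of_real (Im (cnj (z x) * w x)) * w x" and
        \<phi>' = "\<lambda>x. K5 * M\<^sup>2 * exp (- (\<sigma> * M * x)) + 3 * E x"])
    show "continuous_on {t..s} w"
      using assms by (intro continuous_at_imp_continuous_on ballI)
        (auto intro: has_vector_derivative_continuous[OF w_deriv])
    show "((\<lambda>x. - \<Phi> x) has_vector_derivative K5 * M\<^sup>2 * exp (- (\<sigma> * M * x)) + 3 * E x) (at x)" for x
      using DERIV_minus[OF Phi_deriv[of x]]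
      by (simp only: has_real_derivative_iff_has_vector_derivative minus_minus)
    then show "continuous_on {t..s} (\<lambda>x. - \<Phi> x)"
      by (intro continuous_at_imp_continuous_on ballI) (auto intro: has_vector_derivative_continuous)
  qed (use assms False w_deriv norm_w_deriv_le in auto)
  then show ?thesis using Phi_nonneg[of s] by simp
qed (simp add: Phi_nonneg)

definition "K6 = K5 / \<sigma>\<^sup>2 + 3 * B / \<beta>\<^sup>2"

text \<open>The rate 1/t originates here: M e^(-\<sigma> M t) \<le> 1/(\<sigma> t) for every
  \<open>M\<close>, whereas exponential decay is not uniform as \<open>M\<close> tends to 0.\<close>

lemma Phi_le:
  assumes "t > 0"
  shows "\<Phi> t \<le> K6 / t"
proof -
  have "M * exp (- (\<sigma> * M * t)) \<le> 1 / (\<sigma> * t)"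
  proof (cases "M = 0")
    case False
    then have "M * exp (- (\<sigma> * M * t)) \<le> M * (1 / (\<sigma> * M * t))"
      using M sigma assms by (intro mult_left_mono exp_minus_le_inverse) auto
    then show ?thesis using False by simp
  qed (use assms sigma in simp)
  then have "K5 / \<sigma> * (M * exp (- (\<sigma> * M * t))) \<le> K5 / \<sigma> * (1 / (\<sigma> * t))"
    using K5_nonneg sigma by (intro mult_left_mono) auto
  moreover have "3 * B / \<beta> * exp (- (\<beta> * t)) \<le> 3 * B / \<beta> * (1 / (\<beta> * t))"
    using assms B \<beta> by (intro mult_left_mono exp_minus_le_inverse) auto
  ultimately show ?thesis
    by (simp add: \<Phi>_def K6_def E_def power2_eq_square add_divide_distrib mult.assoc)
qed

definition "K7 = 1 + c0 + B / \<beta> + 2 * K3 + (K5 + K5 / \<sigma>) / \<sigma> + (B + 3 * B / \<beta>) / \<beta>"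

text \<open>After \<open>t2\<close> the derivative of \<open>hypvec (z t) - t *\<^sub>R v\<close> is
  at most \<open>sqrt (\<nu> t) + \<Phi> t\<close>, whose integral is bounded independently of
  \<open>M\<close>. Up to \<open>t2\<close> both terms are bounded separately because
  \<open>M * t \<le> K3\<close>. The constant \<open>K7\<close> adds these contributions.\<close>

lemma asymptotics:
  "\<exists>v. (\<lambda>n. w (real n)) \<longlonglongrightarrow> v \<and>
    (\<forall>t\<ge>t0. norm (w t - v) \<le> K6 / t \<and> norm (hypvec (z t) / of_real t - v) \<le> K7 / t)"
proof -
  have "\<exists>v. (\<lambda>n. w (real n)) \<longlonglongrightarrow> v"
  proof (rule Cauchy_convergent[unfolded convergent_def], rule metric_CauchyI)
    fix e :: real assume "e > 0"
    obtain N :: nat where N: "real N > max t0 (2 * K6 / e)"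
      using reals_Archimedean2 by blast
    then have "N > 0" using t0 by (intro gr0I) auto
    then have "\<Phi> (real N) \<le> K6 / real N" by (intro Phi_le) simp
    also have "K6 / real N < e / 2"
      using N \<open>N > 0\<close> \<open>e > 0\<close> by (simp add: field_simps)
    finally have "dist (w (real n)) (w (real N)) < e / 2" if "n \<ge> N" for n
      using w_diff_le[of "real N" "real n"] that N by (simp add: dist_norm)
    then have "dist (w (real m)) (w (real n)) < e" if "m \<ge> N" "n \<ge> N" for m n
      using dist_triangle_half_l[of "w (real m)" "w (real N)" e "w (real n)"] that by blast
    then show "\<exists>N. \<forall>m\<ge>N. \<forall>n\<ge>N. dist (w (real m)) (w (real n)) < e" by blast
  qed
  then obtain v where v: "(\<lambda>n. w (real n)) \<longlonglongrightarrow> v" by blast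
  have wv: "norm (w t - v) \<le> \<Phi> t" if "t \<ge> t0" for t
  proof -
    have "(\<lambda>n. norm (w (real n) - w t)) \<longlonglongrightarrow> norm (v - w t)"
      by (intro tendsto_intros v)
    moreover have "\<forall>\<^sub>F n in sequentially. norm (w (real n) - w t) \<le> \<Phi> t"
      using eventually_ge_at_top[of "nat \<lceil>t\<rceil>"]
      by eventually_elim (use w_diff_le that in \<open>simp add: nat_le_iff ceiling_le_iff\<close>)
    ultimately have "norm (v - w t) \<le> \<Phi> t"
      by (rule tendsto_upperbound) simp
    then show ?thesis by (simp add: norm_minus_commute)
  qed
  have vM: "norm v \<le> M"
  proof -
    have "(\<lambda>n. norm (w (real n))) \<longlonglongrightarrow> norm v" by (intro tendsto_intros v)
    moreover have "(\<lambda>n. M + B * exp (- (\<beta> * real n))) \<longlonglongrightarrow> M + B * 0"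
    proof (intro tendsto_intros)
      have "(\<lambda>n. exp (- \<beta>) ^ n) \<longlonglongrightarrow> 0" using \<beta> by (intro LIMSEQ_power_zero) simp
      then show "(\<lambda>n. exp (- (\<beta> * real n))) \<longlonglongrightarrow> 0"
        by (simp add: exp_of_nat_mult[symmetric] mult.commute)
    qed
    moreover have "\<forall>\<^sub>F n in sequentially. norm (w (real n)) \<le> M + B * exp (- (\<beta> * real n))"
      using eventually_ge_at_top[of "nat \<lceil>t0\<rceil>"]
      by eventually_elim (use w_le in \<open>simp add: nat_le_iff ceiling_le_iff\<close>)
    ultimately show ?thesis
      using tendsto_le[of sequentially] by fastforce
  qed
  have hyp_le: "norm (hypvec (z t)) \<le> 1 + c0 + B / \<beta> + M * t" if "t \<ge> t0" for t
    using hypvec_norm_le[OF disc[of t]] lnc_le[OF that] ln_2_less_1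
    by (simp add: lnc_def sq_def)
  have tail: "0 \<le> (K5 + K5 / \<sigma>) / \<sigma>" "0 \<le> (B + 3 * B / \<beta>) / \<beta>"
    using K5_nonneg sigma B \<beta> by auto
  have hv: "norm (hypvec (z t) - t *\<^sub>R v) \<le> K7" if t: "t \<ge> t0" for t
  proof (cases "M > 0 \<and> t > t2")
    case True
    then have M0: "M > 0" and tt: "t2 < t" by auto
    have t20: "t0 \<le> t2" using t1_ge[OF M0] t2_ge[OF M0] by simp
    \<comment> \<open>Positive \<open>r\<close> forces \<open>z x\<close> to be nonzero, so the
      curve avoids the origin, where the polar form breaks down.\<close>
    have nz: "z x \<noteq> 0" if "x \<ge> t2" for x
      using r_ge_half[OF M0 that] M0 by (auto simp: r_def p_def)
    have "\<exists>h. ((\<lambda>x. hypvec (z x)) has_vector_derivative h) (at x) \<and> norm (h - w x) \<le> sqrt (\<nu> x)"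
      if x: "x \<ge> t2" for x
    proof -
      have x0: "x \<ge> t0" using x t20 by simp
      have "\<bar>\<psi> x\<bar> / norm (z x) \<le> sqrt (\<nu> x)"
        using abs_psi_le[of x] nz[OF x] by (simp add: pos_divide_le_eq)
      then show ?thesis
        using hypvec_has_derivative[OF z_deriv[OF x0] nz[OF x] disc] by (force simp: \<psi>_def)
    qed
    then obtain h where h: "\<And>x. x \<ge> t2 \<Longrightarrow> ((\<lambda>x. hypvec (z x)) has_vector_derivative h x) (at x)"
      "\<And>x. x \<ge> t2 \<Longrightarrow> norm (h x - w x) \<le> sqrt (\<nu> x)"
      by metis
    \<comment> \<open>Minus the tail integral of the bound on the derivative of
      \<open>hypvec (z x) - x *\<^sub>R v\<close>.\<close>
    define \<Psi> where "\<Psi> x = - ((K5 + K5 / \<sigma>) / \<sigma> * exp (- (\<sigma> * M * x)) + (1 + 3 / \<beta>) / \<beta> * E x)" for x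
    have \<Psi>': "(\<Psi> has_real_derivative (K5 + K5 / \<sigma>) * M * exp (- (\<sigma> * M * x)) + (1 + 3 / \<beta>) * E x) (at x)" for x
      unfolding \<Psi>_def[abs_def]
      by (rule derivative_eq_intros E_deriv refl)+ (use sigma \<beta> in \<open>simp add: field_simps\<close>)
    have dh: "((\<lambda>x. hypvec (z x) - x *\<^sub>R v) has_vector_derivative h x - v) (at x)" if "x \<ge> t2" for x
      by (auto intro!: derivative_eq_intros h(1) that)
    have "norm ((hypvec (z t) - t *\<^sub>R v) - (hypvec (z t2) - t2 *\<^sub>R v)) \<le> \<Psi> t - \<Psi> t2"
    proof (rule differentiable_bound_general[OF tt])
      show "continuous_on {t2..t} (\<lambda>x. hypvec (z x) - x *\<^sub>R v)"
        by (intro continuous_at_imp_continuous_on ballI)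
          (auto intro: has_vector_derivative_continuous[OF dh])
      show "continuous_on {t2..t} \<Psi>"
        by (intro continuous_at_imp_continuous_on ballI) (rule DERIV_isCont[OF \<Psi>'])
      fix x assume x: "t2 < x" "x < t"
      show "((\<lambda>x. hypvec (z x) - x *\<^sub>R v) has_vector_derivative h x - v) (at x)"
        using x by (intro dh) simp
      show "(\<Psi> has_vector_derivative (K5 + K5 / \<sigma>) * M * exp (- (\<sigma> * M * x)) + (1 + 3 / \<beta>) * E x) (at x)"
        using \<Psi>' by (simp add: has_real_derivative_iff_has_vector_derivative)
      have "norm (h x - v) \<le> norm (h x - w x) + norm (w x - v)"
        using norm_triangle_ineq[of "h x - w x" "w x - v"] by simp
      also have "\<dots> \<le> sqrt (\<nu> x) + \<Phi> x" using h(2) wv x t20 by (intro add_mono) auto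
      also have "\<dots> \<le> K5 * M * exp (- (\<sigma> * M * x)) + E x + \<Phi> x"
        using sqrt_nu_decay[of x] x t20 by simp
      finally show "norm (h x - v) \<le> (K5 + K5 / \<sigma>) * M * exp (- (\<sigma> * M * x)) + (1 + 3 / \<beta>) * E x"
        by (simp add: \<Phi>_def algebra_simps)
    qed
    moreover have "\<Psi> t \<le> 0"
    proof -
      have "0 \<le> (K5 + K5 / \<sigma>) / \<sigma> * exp (- (\<sigma> * M * t))" by (rule mult_nonneg_nonneg[OF tail(1)]) simp
      moreover have "0 \<le> (1 + 3 / \<beta>) / \<beta> * E t" using E_pos[of t] \<beta> by simp
      ultimately show ?thesis unfolding \<Psi>_def by linarith
    qed
    moreover have "- \<Psi> t2 \<le> (K5 + K5 / \<sigma>) / \<sigma> * 1 + (1 + 3 / \<beta>) / \<beta> * B"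
      unfolding \<Psi>_def minus_minus
      using K5_nonneg sigma B \<beta> M t20 t0
      by (intro add_mono mult_left_mono) (auto simp: E_def mult_le_cancel_left1)
    moreover have "(1 + 3 / \<beta>) / \<beta> * B = (B + 3 * B / \<beta>) / \<beta>"
      by (simp add: add_divide_distrib distrib_right)
    ultimately have 1: "norm ((hypvec (z t) - t *\<^sub>R v) - (hypvec (z t2) - t2 *\<^sub>R v))
       \<le> (K5 + K5 / \<sigma>) / \<sigma> + (B + 3 * B / \<beta>) / \<beta>"
      by linarith
    have "norm (t2 *\<^sub>R v) \<le> M * t2"
      using vM t20 t0 mult_right_mono[of "norm v" M t2] by (simp add: mult.commute)
    then have "norm (hypvec (z t2) - t2 *\<^sub>R v) \<le> 1 + c0 + B / \<beta> + 2 * K3"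
      using norm_triangle_ineq4[of "hypvec (z t2)" "t2 *\<^sub>R v"] hyp_le[OF t20] M_t2[OF M0] by linarith
    then show ?thesis
      using 1 norm_triangle_sub[of "hypvec (z t) - t *\<^sub>R v" "hypvec (z t2) - t2 *\<^sub>R v"]
      unfolding K7_def by linarith
  next
    case False
    have "M * t \<le> K3"
    proof (cases "M = 0")
      case False
      then have "M > 0" "t \<le> t2" using \<open>\<not> (M > 0 \<and> t > t2)\<close> M by auto
      then show ?thesis using M_t2[OF \<open>M > 0\<close>] mult_left_mono[OF \<open>t \<le> t2\<close> M(1)] by linarith
    qed (use K_nonneg in simp)
    moreover have "norm (t *\<^sub>R v) \<le> M * t"
      using vM t t0 mult_right_mono[of "norm v" M t] by (simp add: mult.commute)
    ultimately show ?thesis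
      using norm_triangle_ineq4[of "hypvec (z t)" "t *\<^sub>R v"] hyp_le[OF t] tail
      unfolding K7_def by linarith
  qed
  have "norm (hypvec (z t) / of_real t - v) \<le> K7 / t" if "t \<ge> t0" for t
  proof -
    have "t > 0" using that t0 by simp
    then have "hypvec (z t) / of_real t - v = (1 / t) *\<^sub>R (hypvec (z t) - t *\<^sub>R v)"
      by (simp add: scaleR_conv_of_real field_simps)
    then have "norm (hypvec (z t) / of_real t - v) = 1 / t * norm (hypvec (z t) - t *\<^sub>R v)"
      using \<open>t > 0\<close> by simp
    also have "\<dots> \<le> 1 / t * K7" using hv[OF that] \<open>t > 0\<close> by (intro mult_left_mono) auto
    finally show ?thesis by simp
  qed
  moreover have "norm (w t - v) \<le> K6 / t" if "t \<ge> t0" for t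
    using wv[OF that] Phi_le[of t] that t0 by simp
  ultimately show ?thesis using v by blast
qed

end

section \<open>Decay estimates and asymptotic velocity\<close>

lemma periodic_bounded:
  fixes g :: "real \<times> real \<Rightarrow> real"
  assumes "continuous_on UNIV g" "\<And>\<theta>. g (t, \<theta> + 2 * pi) = g (t, \<theta>)"
  shows "\<exists>N. \<forall>\<theta>. g (t, \<theta>) \<le> N"
proof -
  have "continuous_on {0..2*pi} (\<lambda>\<theta>. g (t, \<theta>))"
    by (rule continuous_on_compose2[OF assms(1)]) (auto intro!: continuous_intros)
  then obtain m where m: "\<And>\<theta>. \<theta> \<in> {0..2*pi} \<Longrightarrow> g (t, \<theta>) \<le> g (t, m)"
    using continuous_attains_sup[of "{0..2*pi}" "\<lambda>\<theta>. g (t, \<theta>)"]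
    by (metis atLeastAtMost_iff compact_Icc empty_iff pi_ge_zero mult_nonneg_nonneg order_refl zero_le_numeral)
  have "g (t, \<theta>) \<le> g (t, m)" for \<theta>
  proof -
    obtain x where x: "x \<in> {0..2*pi}" and "\<And>f :: real \<Rightarrow> real. (\<forall>\<theta>. f (\<theta> + 2 * pi) = f \<theta>) \<Longrightarrow> f \<theta> = f x"
      using periodic_representative[where 'a = real] by meson
    from this(2)[of "\<lambda>\<theta>. g (t, \<theta>)"] assms(2) have "g (t, \<theta>) = g (t, x)" by simp
    then show ?thesis using m[OF x] by simp
  qed
  then show ?thesis by blast
qed

text \<open>With \<open>e\<close> the tail integral of the bound, both \<open>g + e\<close> and
  \<open>- g + e\<close> are nonincreasing, which makes \<open>g\<close> Cauchy.\<close>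

lemma exponentially_small_derivative_limit:
  fixes g :: "real \<Rightarrow> real"
  assumes "\<delta> > 0" "A \<ge> 0"
    and der: "\<And>t. t \<ge> t0 \<Longrightarrow> (g has_real_derivative g' t) (at t)"
    and le: "\<And>t. t \<ge> t0 \<Longrightarrow> \<bar>g' t\<bar> \<le> A * exp (- (\<delta> * t))"
  shows "\<exists>L. (\<lambda>n. g (real n)) \<longlonglongrightarrow> L \<and> (\<forall>t\<ge>t0. \<bar>g t - L\<bar> \<le> A / \<delta> * exp (- (\<delta> * t)))"
proof -
  define e where "e t = A / \<delta> * exp (- (\<delta> * t))" for t
  have de: "(e has_real_derivative - (A * exp (- (\<delta> * t)))) (at t)" for t
    unfolding e_def[abs_def] using assms(1) by (auto intro!: derivative_eq_intros)
  have diff: "\<bar>g s - g t\<bar> \<le> e t" if "t0 \<le> t" "t \<le> s" for s t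
  proof -
    have "g s + e s \<le> g t + e t"
    proof (rule DERIV_nonpos_le[OF that(2)])
      fix x assume "t \<le> x"
      then have x: "t0 \<le> x" using that by simp
      show "\<exists>y. ((\<lambda>x. g x + e x) has_real_derivative y) (at x) \<and> y \<le> 0"
        using DERIV_add[OF der[OF x] de[of x]] le[OF x] by (intro exI conjI) (assumption, linarith)
    qed
    moreover have "- g s + e s \<le> - g t + e t"
    proof (rule DERIV_nonpos_le[OF that(2)])
      fix x assume "t \<le> x"
      then have x: "t0 \<le> x" using that by simp
      show "\<exists>y. ((\<lambda>x. - g x + e x) has_real_derivative y) (at x) \<and> y \<le> 0"
        using DERIV_add[OF DERIV_minus[OF der[OF x]] de[of x]] le[OF x] by (intro exI conjI) (assumption, linarith)
    qed
    moreover have "0 \<le> e s" using assms by (simp add: e_def)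
    ultimately show ?thesis by linarith
  qed
  have e0: "(\<lambda>n. e (real n)) \<longlonglongrightarrow> 0"
  proof -
    have "(\<lambda>n. A / \<delta> * exp (- \<delta>) ^ n) \<longlonglongrightarrow> A / \<delta> * 0"
      using assms(1) by (intro tendsto_mult LIMSEQ_power_zero tendsto_const) simp
    then show ?thesis by (simp add: e_def exp_of_nat_mult[symmetric] mult.commute)
  qed
  have "\<exists>L. (\<lambda>n. g (real n)) \<longlonglongrightarrow> L"
  proof (rule Cauchy_convergent[unfolded convergent_def], rule metric_CauchyI)
    fix d :: real assume "d > 0"
    have "\<forall>\<^sub>F n in sequentially. e (real n) < d / 2"
      using order_tendstoD(2)[OF e0, of "d / 2"] \<open>d > 0\<close> by simp
    moreover have "\<forall>\<^sub>F n in sequentially. t0 \<le> real n"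
      using eventually_ge_at_top[of "nat \<lceil>t0\<rceil>"]
      by eventually_elim (simp add: nat_le_iff ceiling_le_iff)
    ultimately obtain N where N: "e (real N) < d / 2" "t0 \<le> real N"
      using eventually_happens[OF eventually_conj] by fastforce
    have "dist (g (real n)) (g (real N)) < d / 2" if "n \<ge> N" for n
      using diff[of "real N" "real n"] that N by (simp add: dist_real_def)
    then have "dist (g (real m)) (g (real n)) < d" if "m \<ge> N" "n \<ge> N" for m n
      using dist_triangle_half_l[of "g (real m)" "g (real N)" d "g (real n)"] that by blast
    then show "\<exists>N. \<forall>m\<ge>N. \<forall>n\<ge>N. dist (g (real m)) (g (real n)) < d" by blast
  qed
  then obtain L where L: "(\<lambda>n. g (real n)) \<longlonglongrightarrow> L" by blast
  have "\<bar>g t - L\<bar> \<le> e t" if "t \<ge> t0" for t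
  proof -
    have "(\<lambda>n. \<bar>g (real n) - g t\<bar>) \<longlonglongrightarrow> \<bar>L - g t\<bar>" by (intro tendsto_intros L)
    moreover have "\<forall>\<^sub>F n in sequentially. \<bar>g (real n) - g t\<bar> \<le> e t"
      using eventually_ge_at_top[of "nat \<lceil>t\<rceil>"]
      by eventually_elim (use diff that in \<open>simp add: nat_le_iff ceiling_le_iff\<close>)
    ultimately have "\<bar>L - g t\<bar> \<le> e t" by (rule tendsto_upperbound) simp
    then show ?thesis by linarith
  qed
  then show ?thesis using L unfolding e_def by blast
qed

lemma pt_periodic:
  assumes "\<And>t \<theta>. f (t, \<theta> + 2 * pi) = f (t, \<theta>)"
  shows "pt f (t, \<theta> + 2 * pi) = pt f (t, \<theta>)"
  by (simp add: pt_def assms)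

lemma pth_periodic:
  assumes "smooth2 f" "\<And>t \<theta>. f (t, \<theta> + 2 * pi) = f (t, \<theta>)"
  shows "pth f (t, \<theta> + 2 * pi) = pth f (t, \<theta>)"
proof -
  note f = has_partials_2[OF smooth2_partials(1)[OF assms(1)]]
  have "((\<lambda>s. f (t, s + 2 * pi)) has_vector_derivative 1 *\<^sub>R pth f (t, \<theta> + 2 * pi)) (at \<theta>)"
  proof -
    have "((\<lambda>s. s + 2 * pi) has_vector_derivative 1) (at \<theta>)"
      by (auto intro!: derivative_eq_intros)
    from vector_diff_chain_at[OF this f[of t "\<theta> + 2 * pi"]] show ?thesis by (simp only: o_def)
  qed
  then show ?thesis
    using vector_derivative_unique_at f[of t \<theta>] by (fastforce simp: assms(2))
qed

lemma norm_sq_half_sum_le: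
  fixes a b c :: complex
  assumes "a + b = 2 * c"
  shows "(norm c)\<^sup>2 \<le> ((norm a)\<^sup>2 + (norm b)\<^sup>2) / 2"
proof -
  have "2 * norm c \<le> norm a + norm b"
    using norm_triangle_ineq[of a b] assms by (simp add: norm_mult)
  then have "(2 * norm c)\<^sup>2 \<le> (norm a + norm b)\<^sup>2" by (intro power_mono) auto
  then show ?thesis
    using zero_le_power2[of "norm a - norm b"] by (simp add: power2_eq_square algebra_simps)
qed

section \<open>Sup-norm estimates for periodic solutions\<close>

locale periodic_disc_wave_map = disc_wave_map +
  assumes periodic: "z (t, \<theta> + 2 * pi) = z (t, \<theta>)"
begin

lemma w_periodic: "w (t, \<theta> + 2 * pi) = w (t, \<theta>)"
  and y_periodic: "y (t, \<theta> + 2 * pi) = y (t, \<theta>)"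
  and us_periodic: "us s (t, \<theta> + 2 * pi) = us s (t, \<theta>)"
  and Xs_periodic: "Xs s (t, \<theta> + 2 * pi) = Xs s (t, \<theta>)"
proof -
  note s = smooth2_partials
  have z1: "pt z (t, \<theta> + 2 * pi) = pt z (t, \<theta>)" for t \<theta> by (rule pt_periodic[OF periodic])
  have z2: "pth z (t, \<theta> + 2 * pi) = pth z (t, \<theta>)" for t \<theta> by (rule pth_periodic[OF smooth periodic])
  have z12: "pth (pt z) (t, \<theta> + 2 * pi) = pth (pt z) (t, \<theta>)"
    by (rule pth_periodic[OF s(2)[OF smooth] z1])
  have z22: "pth (pth z) (t, \<theta> + 2 * pi) = pth (pth z) (t, \<theta>)"
    by (rule pth_periodic[OF s(3)[OF smooth] z2])
  show w: "w (t, \<theta> + 2 * pi) = w (t, \<theta>)" by (simp add: w_def lam_def periodic z1)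
  show y: "y (t, \<theta> + 2 * pi) = y (t, \<theta>)" by (simp add: y_def lam_def periodic z2)
  show "us s (t, \<theta> + 2 * pi) = us s (t, \<theta>)" by (simp add: us_def w y)
  show "Xs s (t, \<theta> + 2 * pi) = Xs s (t, \<theta>)"
    by (simp add: Xs_def U_def Y_def lam_def periodic z12 z22 w y)
qed

lemma continuous_on_us [continuous_intros]: "continuous_on S (us s)"
  and continuous_on_Xs [continuous_intros]: "continuous_on S (Xs s)"
  and continuous_on_y [continuous_intros]: "continuous_on S y"
  and continuous_on_w [continuous_intros]: "continuous_on S w"
  and continuous_on_z [continuous_intros]: "continuous_on S z"
  by (rule has_partials_continuous, rule hp_us hp_Xs hp_y hp_w hp_z)+

text \<open>The comparison functions solve the linear system a_s' = (a_(-s) - a_s)/2, whose mean is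
  conserved and whose difference decays like e^(-t).\<close>

lemma characteristic_energy_bound:
  assumes init: "\<And>s \<theta>. s \<in> {1, -1} \<Longrightarrow> (norm (us s (\<tau>0, \<theta>)))\<^sup>2 \<le> A s"
    and "s \<in> {1, -1}" "t \<ge> \<tau>0"
  shows "(norm (us s (t, \<theta>)))\<^sup>2 \<le> (A 1 + A (-1)) / 2 + s * ((A 1 - A (-1)) / 2 * exp (\<tau>0 - t))"
proof (rule field_le_epsilon)
  fix e :: real assume "e > 0"
  \<comment> \<open>A small tilt in time makes the comparison strict; at the target time it costs at
    most \<open>e\<close>.\<close>
  define \<epsilon> where "\<epsilon> = e / (1 + (t - \<tau>0))"
  have \<epsilon>: "\<epsilon> > 0" "\<epsilon> * (t - \<tau>0) \<le> e"
    using \<open>e > 0\<close> \<open>t \<ge> \<tau>0\<close> by (auto simp: \<epsilon>_def divide_simps)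
  define D where "D = (A 1 - A (-1)) / 2"
  define a where "a s t = (A 1 + A (-1)) / 2 + s * (D * exp (\<tau>0 - t)) + \<epsilon> * (t - \<tau>0)" for s t
  define G where "G s p = (norm (us s p))\<^sup>2 - a s (fst p)" for s p
  have a': "(a s has_real_derivative (\<epsilon> - s * (D * exp (\<tau>0 - t)))) (at t)" for s t
    unfolding a_def[abs_def] by (auto intro!: derivative_eq_intros)
  have "G s (t, \<theta>) \<le> 0"
  proof (rule maximum_principle_characteristics[where S = "{1, -1}" and ?t0.0 = \<tau>0 and G = G])
    show "continuous_on UNIV (G s)" for s
      unfolding G_def[abs_def] a_def by (intro continuous_intros)
    show "G s (\<tau>0, \<theta>) \<le> 0" if "s \<in> {1, -1}" for s \<theta>
    proof -
      have "a s \<tau>0 = A s" using that by (auto simp: a_def D_def field_simps)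
      then show ?thesis using init[OF that, of \<theta>] by (simp add: G_def)
    qed
    fix s t \<theta>
    assume s: "s \<in> {1, -1::real}" and max: "\<And>s'. s' \<in> {1, -1} \<Longrightarrow> G s' (t, \<theta>) \<le> G s (t, \<theta>)"
    have ss: "s * s = 1" and ms: "- s \<in> {1, -1}" using s by auto
    let ?d = "Re (cnj (us s (t, \<theta>)) * us (- s) (t, \<theta>)) - (norm (us s (t, \<theta>)))\<^sup>2 - (\<epsilon> - s * (D * exp (\<tau>0 - t)))"
    have "((\<lambda>r. G s (r, \<theta> + s * (exp (- r) - exp (- t)))) has_real_derivative ?d) (at t)"
      unfolding G_def fst_conv by (intro DERIV_diff us_along_characteristic[OF ss] a')
    moreover have "?d < 0"
    proof -
      have "Re (cnj (us s (t, \<theta>)) * us (- s) (t, \<theta>)) \<le> norm (us s (t, \<theta>)) * norm (us (- s) (t, \<theta>))"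
        using complex_Re_le_cmod[of "cnj (us s (t, \<theta>)) * us (- s) (t, \<theta>)"] by (simp only: norm_mult complex_mod_cnj)
      also have "\<dots> \<le> ((norm (us s (t, \<theta>)))\<^sup>2 + (norm (us (- s) (t, \<theta>)))\<^sup>2) / 2"
        using zero_le_power2[of "norm (us s (t, \<theta>)) - norm (us (- s) (t, \<theta>))"]
        by (simp add: power2_eq_square algebra_simps)
      finally have "?d \<le> ((norm (us (- s) (t, \<theta>)))\<^sup>2 - (norm (us s (t, \<theta>)))\<^sup>2) / 2 - \<epsilon> + s * (D * exp (\<tau>0 - t))"
        by (simp add: field_simps)
      \<comment> \<open>Maximality over the index bounds the difference of the two squared norms by
        the difference of their comparison functions.\<close>
      moreover have "(norm (us (- s) (t, \<theta>)))\<^sup>2 - (norm (us s (t, \<theta>)))\<^sup>2 \<le> - (2 * (s * (D * exp (\<tau>0 - t))))"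
        using max[OF ms] by (simp add: G_def a_def algebra_simps)
      moreover have "d < 0" if "d \<le> x / 2 - \<epsilon> + q" "x \<le> - (2 * q)" for d x q
        using that \<epsilon>(1) by linarith
      ultimately show ?thesis by blast
    qed
    ultimately show "\<exists>d<0. ((\<lambda>r. G s (r, \<theta> + s * (exp (- r) - exp (- t)))) has_real_derivative d) (at t)"
      by blast
  qed (use assms us_periodic in \<open>auto simp: G_def\<close>)
  then show "(norm (us s (t, \<theta>)))\<^sup>2 \<le> (A 1 + A (-1)) / 2 + s * ((A 1 - A (-1)) / 2 * exp (\<tau>0 - t)) + e"
    using \<epsilon>(2) by (simp add: G_def a_def D_def)
qed

text \<open>Dividing \<open>Xs\<close> by \<open>\<kappa>\<close> balances the system. Where
  \<open>y\<close> dominates, \<open>norm U \<le> \<kappa> * norm y\<close>; where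
  \<open>Xs s\<close> dominates, the curvature term is at most
  \<open>\<kappa> * norm (Xs s)\<close>. Both growth rates are then at most \<open>\<kappa>\<close>,
  strictly below \<open>k\<close>.\<close>

lemma second_order_growth:
  assumes \<kappa>: "0 < \<kappa>" "\<kappa> < k"
    and us: "\<And>s t \<theta>. s \<in> {1, -1} \<Longrightarrow> t \<ge> t1 \<Longrightarrow> norm (us s (t, \<theta>)) \<le> \<kappa>"
  shows "\<exists>C\<ge>0. \<forall>t\<ge>t1. \<forall>\<theta>. norm (y (t, \<theta>)) \<le> C * exp (k * t) \<and>
    (\<forall>s\<in>{1, -1}. norm (Xs s (t, \<theta>)) \<le> \<kappa> * C * exp (k * t))"
proof -
  \<comment> \<open>Index 0 carries \<open>y\<close>, which is followed along lines of constant
    angle.\<close>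
  define q where "q s p = (if s = 0 then (norm (y p))\<^sup>2 else (norm (Xs s p))\<^sup>2 / \<kappa>\<^sup>2)" for s p
  define Q where "Q s p = exp (- (2 * k * fst p)) * q s p" for s p
  have contq: "continuous_on UNIV (q s)" for s
    unfolding q_def[abs_def] using \<kappa> by (cases "s = 0") (auto intro!: continuous_intros)
  have contQ: "continuous_on UNIV (Q s)" for s
    unfolding Q_def[abs_def] by (intro continuous_intros contq)
  have perQ: "Q s (t, \<theta> + 2 * pi) = Q s (t, \<theta>)" for s t \<theta>
    by (simp add: Q_def q_def y_periodic Xs_periodic)
  have "\<forall>s. \<exists>N. \<forall>\<theta>. Q s (t1, \<theta>) \<le> N"
    by (intro allI periodic_bounded contQ perQ)
  then obtain N where N: "\<And>s \<theta>. Q s (t1, \<theta>) \<le> N s" by metis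
  define C2 where "C2 = \<bar>N 0\<bar> + \<bar>N 1\<bar> + \<bar>N (-1)\<bar>"
  have C2: "C2 \<ge> 0" by (simp add: C2_def)
  have expd: "((\<lambda>r. exp (- (2 * k * r))) has_real_derivative - (2 * k * exp (- (2 * k * t)))) (at t)" for t
    by (auto intro!: derivative_eq_intros)
  have bound: "Q s (t, \<theta>) - C2 \<le> 0" if "s \<in> {0, 1, -1}" "t \<ge> t1" for s t \<theta>
  proof (rule maximum_principle_characteristics[where S = "{0, 1, -1}" and ?t0.0 = t1 and G = "\<lambda>s p. Q s p - C2"])
    show "continuous_on UNIV (\<lambda>p. Q s p - C2)" for s by (intro continuous_intros contQ)
    show "Q s (t1, \<theta>) - C2 \<le> 0" if "s \<in> {0, 1, -1}" for s \<theta>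
      using N[of s \<theta>] that by (auto simp: C2_def)
    fix s t \<theta>
    assume s: "s \<in> {0, 1, -1::real}" and t: "t > t1" and pos: "Q s (t, \<theta>) - C2 > 0"
      and max: "\<And>s'. s' \<in> {0, 1, -1} \<Longrightarrow> Q s' (t, \<theta>) - C2 \<le> Q s (t, \<theta>) - C2"
    let ?p = "(t, \<theta>)"
    have qpos: "q s ?p > 0"
    proof -
      have "exp (- (2 * k * t)) * q s ?p > 0" using pos C2 by (simp add: Q_def)
      then show ?thesis by (simp add: zero_less_mult_iff)
    qed
    have qmax: "q s' ?p \<le> q s ?p" if "s' \<in> {0, 1, -1}" for s'
      using max[OF that] by (simp add: Q_def)
    have product: "\<exists>d<0. ((\<lambda>r. Q s (r, \<theta> + s * (exp (- r) - exp (- t))) - C2) has_real_derivative d) (at t)"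
      if "((\<lambda>r. q s (r, \<theta> + s * (exp (- r) - exp (- t)))) has_real_derivative d) (at t)" "d < 2 * k * q s ?p" for d
    proof -
      have "((\<lambda>r. Q s (r, \<theta> + s * (exp (- r) - exp (- t))) - C2) has_real_derivative
          exp (- (2 * k * t)) * (d - 2 * k * q s ?p)) (at t)"
        unfolding Q_def fst_conv
        by (rule derivative_eq_intros expd that(1) refl)+ (simp add: algebra_simps)
      moreover have "exp (- (2 * k * t)) * (d - 2 * k * q s ?p) < 0"
        using that(2) by (simp add: mult_pos_neg)
      ultimately show ?thesis by blast
    qed
    show "\<exists>d<0. ((\<lambda>r. Q s (r, \<theta> + s * (exp (- r) - exp (- t))) - C2) has_real_derivative d) (at t)"
    proof (cases "s = 0")
      case True
      have ypos: "(norm (y ?p))\<^sup>2 > 0" using qpos True by (simp add: q_def)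
      have X: "(norm (Xs s' ?p))\<^sup>2 \<le> \<kappa>\<^sup>2 * (norm (y ?p))\<^sup>2" if "s' \<in> {1, -1}" for s'
        using qmax[of s'] that True \<kappa> by (auto simp: q_def pos_divide_le_eq mult.commute)
      have "(norm (U ?p))\<^sup>2 \<le> ((norm (Xs 1 ?p))\<^sup>2 + (norm (Xs (-1) ?p))\<^sup>2) / 2"
        by (rule norm_sq_half_sum_le) (simp add: Xs_def)
      also have "\<dots> \<le> (\<kappa> * norm (y ?p))\<^sup>2" using X[of 1] X[of "-1"] by (simp add: power_mult_distrib)
      finally have "norm (U ?p) \<le> \<kappa> * norm (y ?p)" by (rule power2_le_imp_le) (use \<kappa> in simp)
      then have "norm (y ?p) * norm (U ?p) \<le> norm (y ?p) * (\<kappa> * norm (y ?p))"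
        by (intro mult_left_mono) auto
      moreover have "Re (cnj (y ?p) * U ?p) \<le> norm (y ?p) * norm (U ?p)"
        using complex_Re_le_cmod[of "cnj (y ?p) * U ?p"] by (simp only: norm_mult complex_mod_cnj)
      ultimately have "2 * Re (cnj (y ?p) * U ?p) \<le> 2 * (\<kappa> * (norm (y ?p))\<^sup>2)"
        by (simp add: power2_eq_square algebra_simps)
      also have "\<dots> < 2 * (k * (norm (y ?p))\<^sup>2)" using \<kappa> ypos by simp
      finally show ?thesis
        using y_along_time[of \<theta> t] True by (intro product) (auto simp: q_def)
    next
      case False
      then have s1: "s \<in> {1, -1}" and ss: "s * s = 1" and ms: "- s \<in> {1, -1}" using s by auto
      define x where "x = norm (Xs s ?p)"
      have xpos: "x\<^sup>2 > 0" using qpos False \<kappa> by (auto simp: q_def x_def)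
      then have "x > 0" by (simp add: x_def)
      have "- s \<in> {0, 1, -1}" using ms by blast
      from qmax[OF this] False have "(norm (Xs (- s) ?p))\<^sup>2 / \<kappa>\<^sup>2 \<le> x\<^sup>2 / \<kappa>\<^sup>2"
        by (simp add: q_def x_def)
      then have "(norm (Xs (- s) ?p))\<^sup>2 \<le> x\<^sup>2"
        using \<kappa> by (simp only: divide_le_cancel) simp
      then have X: "norm (Xs (- s) ?p) \<le> x" by (rule power2_le_imp_le) (use \<open>x > 0\<close> in simp)
      have "(norm (y ?p))\<^sup>2 \<le> x\<^sup>2 / \<kappa>\<^sup>2"
        using qmax[of 0] False by (simp add: q_def x_def)
      then have "(\<kappa> * norm (y ?p))\<^sup>2 \<le> x\<^sup>2" using \<kappa> by (simp add: power_mult_distrib pos_le_divide_eq mult.commute)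
      then have ky: "\<kappa> * norm (y ?p) \<le> x" by (rule power2_le_imp_le) (use \<open>x > 0\<close> in simp)
      have "norm (us 1 ?p) \<le> \<kappa>" "norm (us (-1) ?p) \<le> \<kappa>" using us t by auto
      moreover have "2 * norm (w ?p) \<le> norm (us 1 ?p) + norm (us (-1) ?p)"
        using norm_triangle_ineq[of "us 1 ?p" "us (-1) ?p"] by (simp add: us_def norm_mult flip: mult_2)
      ultimately have w: "norm (w ?p) \<le> \<kappa>" by linarith
      have "Re (cnj (Xs s ?p) * (kap ?p * us s ?p)) \<le> x * (norm (kap ?p) * norm (us s ?p))"
        using complex_Re_le_cmod[of "cnj (Xs s ?p) * (kap ?p * us s ?p)"] by (simp only: norm_mult complex_mod_cnj x_def)
      also have "\<dots> \<le> x * ((norm (w ?p) * norm (y ?p)) * \<kappa>)"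
        using norm_kap_le us[OF s1, of t \<theta>] t \<open>x > 0\<close> by (intro mult_left_mono mult_mono) auto
      also have "\<dots> = x * (norm (w ?p) * (\<kappa> * norm (y ?p)))" by simp
      also have "\<dots> \<le> x * (\<kappa> * x)"
        using w ky \<kappa> \<open>x > 0\<close> by (intro mult_left_mono mult_mono) auto
      finally have 1: "Re (cnj (Xs s ?p) * (kap ?p * us s ?p)) \<le> \<kappa> * x\<^sup>2"
        by (simp add: power2_eq_square algebra_simps)
      \<comment> \<open>By maximality the exchange term is absorbed by the negative square of
        \<open>norm (Xs s ?p)\<close>.\<close>
      have "Re (cnj (Xs s ?p) * Xs (- s) ?p) \<le> x * norm (Xs (- s) ?p)"
        using complex_Re_le_cmod[of "cnj (Xs s ?p) * Xs (- s) ?p"] by (simp only: norm_mult complex_mod_cnj x_def)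
      also have "\<dots> \<le> x * x" using X \<open>x > 0\<close> by (intro mult_left_mono) auto
      finally have 2: "Re (cnj (Xs s ?p) * Xs (- s) ?p) \<le> x\<^sup>2" by (simp add: power2_eq_square)
      let ?d = "2 * Re (cnj (Xs s ?p) * (kap ?p * us s ?p)) + Re (cnj (Xs s ?p) * Xs (- s) ?p) - (norm (Xs s ?p))\<^sup>2"
      have "?d \<le> 2 * (\<kappa> * x\<^sup>2)" using 1 2 unfolding x_def by linarith
      also have "\<dots> < 2 * (k * x\<^sup>2)" using \<kappa> xpos by simp
      finally have "?d / \<kappa>\<^sup>2 < 2 * (k * x\<^sup>2) / \<kappa>\<^sup>2" using \<kappa> by (intro divide_strict_right_mono) auto
      then have d: "?d / \<kappa>\<^sup>2 < 2 * k * q s ?p" using False by (simp add: q_def x_def)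
      show ?thesis
        by (rule product[OF _ d])
          (use DERIV_cdivide[OF Xs_along_characteristic[OF ss, of \<theta> t], of "\<kappa>\<^sup>2"] False in \<open>simp only: q_def if_False\<close>)
    qed
  qed (use that perQ in auto)
  have sq: "q s (t, \<theta>) \<le> (sqrt C2 * exp (k * t))\<^sup>2" if "s \<in> {0, 1, -1}" "t \<ge> t1" for s t \<theta>
  proof -
    have "q s (t, \<theta>) = exp (2 * k * t) * Q s (t, \<theta>)"
      by (simp add: Q_def mult.assoc[symmetric] exp_add[symmetric])
    also have "\<dots> \<le> exp (2 * k * t) * C2" using bound[OF that, of \<theta>] by (intro mult_left_mono) auto
    also have "\<dots> = (sqrt C2 * exp (k * t))\<^sup>2"
      using C2 by (simp add: power_mult_distrib exp_double[symmetric] algebra_simps)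
    finally show ?thesis .
  qed
  show ?thesis
  proof (intro exI[of _ "sqrt C2"] conjI allI impI ballI)
    fix t \<theta> :: real assume t: "t \<ge> t1"
    show "norm (y (t, \<theta>)) \<le> sqrt C2 * exp (k * t)"
      by (rule power2_le_imp_le) (use sq[of 0 t \<theta>] t C2 in \<open>simp_all add: q_def\<close>)
    fix s :: real assume s: "s \<in> {1, -1}"
    have "(norm (Xs s (t, \<theta>)))\<^sup>2 \<le> (\<kappa> * sqrt C2 * exp (k * t))\<^sup>2"
      using sq[of s t \<theta>] s t \<kappa> by (auto simp: q_def pos_divide_le_eq power_mult_distrib algebra_simps)
    then show "norm (Xs s (t, \<theta>)) \<le> \<kappa> * sqrt C2 * exp (k * t)"
      by (rule power2_le_imp_le) (use \<kappa> C2 in simp)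
  qed (use C2 in simp)
qed

section \<open>Reduction to curves at fixed angle\<close>

lemma w_time_derivative:
  "((\<lambda>s. w (s, \<theta>)) has_vector_derivative
    W (t, \<theta>) - \<i> * of_real (Im (cnj (z (t, \<theta>)) * w (t, \<theta>))) * w (t, \<theta>)) (at t)"
proof -
  have "om1 p = \<i> * of_real (Im (cnj (z p) * w p))" for p
    by (simp add: om1_def complex_eq_iff)
  then show ?thesis using has_partials_1[OF hp_w, of \<theta> t] by simp
qed

lemma z_time_derivative:
  "((\<lambda>s. z (s, \<theta>)) has_vector_derivative
    w (t, \<theta>) * of_real ((1 - (norm (z (t, \<theta>)))\<^sup>2) / 2)) (at t)"
proof -
  have "pt z p = w p * of_real ((1 - (norm (z p))\<^sup>2) / 2)" for p
  proof -
    have "z p * cnj (z p) = of_real ((norm (z p))\<^sup>2)" by (simp only: complex_norm_square)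
    then show ?thesis by (simp add: zt_eq)
  qed
  then show ?thesis using has_partials_1[OF hp_z, of \<theta> t] by (simp only:)
qed

lemma normD_eq: "normD (z p) g = norm (lam p * g)"
proof -
  have "(norm (z p))\<^sup>2 < 1" using disc[of p] by (simp add: power_less_one_iff)
  then show ?thesis by (simp add: normD_def lam_of_real norm_mult norm_divide del: of_real_diff of_real_power)
qed

lemma velocity_ode_limit:
  assumes \<delta>: "0 < \<delta>" "\<delta> \<le> 1" and "0 \<le> A" and t1: "1 \<le> t1"
    and w1: "\<And>t \<theta>. t \<ge> t1 \<Longrightarrow> norm (w (t, \<theta>)) \<le> 1"
    and W: "\<And>t \<theta>. t \<ge> t1 \<Longrightarrow> norm (W (t, \<theta>)) \<le> A * exp (- (\<delta> * t))"
  shows "\<exists>K. \<forall>\<theta>. \<exists>v. (\<lambda>n. w (real n, \<theta>)) \<longlonglongrightarrow> v \<and>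
    (\<forall>t\<ge>t1. norm (w (t, \<theta>) - v) \<le> K / t \<and> norm (hypvec (z (t, \<theta>)) / of_real t - v) \<le> K / t)"
proof -
  \<comment> \<open>Half the rate, because the limiting speed may vanish and the bound on the speed
    then comes from a square root.\<close>
  define \<beta> where "\<beta> = \<delta> / 2"
  define B where "B = 1 + A + 2 * A / \<delta>"
  have B: "1 \<le> B" "A \<le> B" "2 * A / \<delta> \<le> B" "1 + 2 * A / \<delta> \<le> B"
    using \<delta> \<open>0 \<le> A\<close> by (auto simp: B_def)
  define c where "c p = ln ((1 + (norm (z p))\<^sup>2) / (1 - (norm (z p))\<^sup>2))" for p
  have z2: "(norm (z p))\<^sup>2 < 1" for p using disc[of p] by (simp add: power_less_one_iff)
  have den: "1 - (norm (z p))\<^sup>2 \<noteq> 0" and ratio: "(1 + (norm (z p))\<^sup>2) / (1 - (norm (z p))\<^sup>2) \<noteq> 0" for p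
  proof -
    show "1 - (norm (z p))\<^sup>2 \<noteq> 0" using z2[of p] by simp
    have "0 < (1 + (norm (z p))\<^sup>2) / (1 - (norm (z p))\<^sup>2)"
      using z2[of p] by (intro divide_pos_pos add_pos_nonneg) auto
    then show "(1 + (norm (z p))\<^sup>2) / (1 - (norm (z p))\<^sup>2) \<noteq> 0"
      by (rule less_imp_neq[THEN not_sym])
  qed
  have "continuous_on UNIV c"
    unfolding c_def[abs_def]
    by (intro continuous_on_ln continuous_on_divide continuous_on_add continuous_on_diff
      continuous_on_const continuous_on_power continuous_on_norm continuous_on_z ballI den ratio)
  moreover have "c (t1, \<theta> + 2 * pi) = c (t1, \<theta>)" for \<theta> by (simp add: c_def periodic)
  ultimately obtain c0 where c0: "\<And>\<theta>. c (t1, \<theta>) \<le> c0"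
    using periodic_bounded by blast
  define c1 where "c1 = max 0 c0"
  \<comment> \<open>\<open>K6\<close> and \<open>K7\<close> take only \<open>\<beta>\<close>,
    \<open>B\<close>, \<open>t1\<close> and \<open>c1\<close> as arguments, so this bound is common
    to all angles although \<open>M\<close> varies with the angle.\<close>
  let ?K = "max (perturbed_geodesic.K6 \<beta> B t1 c1) (perturbed_geodesic.K7 \<beta> B t1 c1)"
  have "\<exists>v. (\<lambda>n. w (real n, \<theta>)) \<longlonglongrightarrow> v \<and>
    (\<forall>t\<ge>t1. norm (w (t, \<theta>) - v) \<le> ?K / t \<and> norm (hypvec (z (t, \<theta>)) / of_real t - v) \<le> ?K / t)" for \<theta>
  proof -
    have der: "((\<lambda>t. (norm (w (t, \<theta>)))\<^sup>2) has_real_derivative 2 * Re (cnj (w (t, \<theta>)) * W (t, \<theta>))) (at t)" for t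
      using norm_squared_has_derivative[OF has_partials_1[OF hp_w, of \<theta> t]]
      by (simp only: Re_skew[OF Re_om(1)])
    have der_le: "\<bar>2 * Re (cnj (w (t, \<theta>)) * W (t, \<theta>))\<bar> \<le> 2 * A * exp (- (\<delta> * t))" if "t \<ge> t1" for t
    proof -
      have "\<bar>Re (cnj (w (t, \<theta>)) * W (t, \<theta>))\<bar> \<le> norm (w (t, \<theta>)) * norm (W (t, \<theta>))"
        using abs_Re_le_cmod[of "cnj (w (t, \<theta>)) * W (t, \<theta>)"] by (simp only: norm_mult complex_mod_cnj)
      also have "\<dots> \<le> 1 * (A * exp (- (\<delta> * t)))"
        using w1[OF that] W[OF that] by (intro mult_mono) auto
      finally show ?thesis by linarith
    qed
    obtain L where L: "(\<lambda>n. (norm (w (real n, \<theta>)))\<^sup>2) \<longlonglongrightarrow> L"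
      "\<And>t. t \<ge> t1 \<Longrightarrow> \<bar>(norm (w (t, \<theta>)))\<^sup>2 - L\<bar> \<le> 2 * A / \<delta> * exp (- (\<delta> * t))"
      using exponentially_small_derivative_limit[OF \<delta>(1) _ der der_le] \<open>0 \<le> A\<close> by auto
    have "L \<ge> 0" by (rule LIMSEQ_le_const[OF L(1)]) auto
    have "L \<le> 1"
    proof (rule LIMSEQ_le_const2[OF L(1)], intro exI allI impI)
      fix n assume "n \<ge> nat \<lceil>t1\<rceil>"
      then have "real n \<ge> t1" by (simp add: nat_le_iff ceiling_le_iff)
      then show "(norm (w (real n, \<theta>)))\<^sup>2 \<le> 1" using w1 by (simp add: power_le_one)
    qed
    define M where "M = sqrt L"
    have M: "0 \<le> M" "M \<le> 1" "M\<^sup>2 = L" using \<open>L \<ge> 0\<close> \<open>L \<le> 1\<close> by (auto simp: M_def)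
    have exp_le: "exp (- (\<delta> * t)) \<le> exp (- (\<beta> * t))" if "t \<ge> t1" for t
      using that t1 \<delta> by (simp add: \<beta>_def)
    have wM: "\<bar>(norm (w (t, \<theta>)))\<^sup>2 - M\<^sup>2\<bar> \<le> B * exp (- (\<beta> * t))" if "t \<ge> t1" for t
    proof -
      have "2 * A / \<delta> * exp (- (\<delta> * t)) \<le> B * exp (- (\<beta> * t))"
        using B exp_le[OF that] by (intro mult_mono) auto
      then show ?thesis using L(2)[OF that] M(3) by simp
    qed
    have w_le: "norm (w (t, \<theta>)) \<le> M + B * exp (- (\<beta> * t))" if "t \<ge> t1" for t
    proof (rule power2_le_imp_le)
      define x where "x = exp (- (\<beta> * t))"
      have x: "x > 0" "exp (- (\<delta> * t)) = x\<^sup>2" by (simp_all add: x_def \<beta>_def exp_double[symmetric])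
      have "(norm (w (t, \<theta>)))\<^sup>2 \<le> M\<^sup>2 + 2 * A / \<delta> * x\<^sup>2"
        using L(2)[OF that] M(3) x by simp
      also have "2 * A / \<delta> * x\<^sup>2 \<le> B\<^sup>2 * x\<^sup>2"
      proof (rule mult_right_mono)
        have "2 * A / \<delta> \<le> 1 * B" using B by simp
        also have "\<dots> \<le> B * B" using B by (intro mult_right_mono) auto
        finally show "2 * A / \<delta> \<le> B\<^sup>2" by (simp add: power2_eq_square)
      qed simp
      also have "M\<^sup>2 + B\<^sup>2 * x\<^sup>2 \<le> (M + B * x)\<^sup>2"
        using M x B by (simp add: power2_eq_square algebra_simps)
      finally show "(norm (w (t, \<theta>)))\<^sup>2 \<le> (M + B * exp (- (\<beta> * t)))\<^sup>2" by (simp add: x_def)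
    qed (use M B in simp)
    have W_le: "norm (W (t, \<theta>)) \<le> B * exp (- (\<beta> * t))" if "t \<ge> t1" for t
    proof -
      have "A * exp (- (\<delta> * t)) \<le> B * exp (- (\<beta> * t))"
        using B exp_le[OF that] by (intro mult_mono) auto
      then show ?thesis using W[OF that, of \<theta>] by linarith
    qed
    interpret perturbed_geodesic \<beta> B t1 c1 M "\<lambda>t. z (t, \<theta>)" "\<lambda>t. w (t, \<theta>)" "\<lambda>t. W (t, \<theta>)"
    proof unfold_locales
      show "0 < \<beta>" "\<beta> \<le> 1" using \<delta> by (simp_all add: \<beta>_def)
      show "0 \<le> c1" by (simp add: c1_def)
      show "((\<lambda>t. z (t, \<theta>)) has_vector_derivative w (t, \<theta>) * of_real ((1 - (norm (z (t, \<theta>)))\<^sup>2) / 2)) (at t)" for t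
        by (rule z_time_derivative)
      show "((\<lambda>t. w (t, \<theta>)) has_vector_derivative
          W (t, \<theta>) - \<i> * of_real (Im (cnj (z (t, \<theta>)) * w (t, \<theta>))) * w (t, \<theta>)) (at t)" for t
        by (rule w_time_derivative)
      show "ln ((1 + (norm (z (t1, \<theta>)))\<^sup>2) / (1 - (norm (z (t1, \<theta>)))\<^sup>2)) \<le> c1"
        using c0[of \<theta>] by (simp add: c_def c1_def)
    qed (fact B(1) t1 M(1,2) disc w1 wM w_le W_le)+
    obtain v where v: "(\<lambda>n. w (real n, \<theta>)) \<longlonglongrightarrow> v"
      "\<And>t. t \<ge> t1 \<Longrightarrow> norm (w (t, \<theta>) - v) \<le> perturbed_geodesic.K6 \<beta> B t1 c1 / t"
      "\<And>t. t \<ge> t1 \<Longrightarrow> norm (hypvec (z (t, \<theta>)) / of_real t - v) \<le> perturbed_geodesic.K7 \<beta> B t1 c1 / t"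
      using asymptotics by blast
    have "perturbed_geodesic.K6 \<beta> B t1 c1 / t \<le> ?K / t" "perturbed_geodesic.K7 \<beta> B t1 c1 / t \<le> ?K / t" if "t \<ge> t1" for t
      using that t1 by (intro divide_right_mono; simp)+
    then show ?thesis using v by (meson order_trans)
  qed
  then show ?thesis by blast
qed

lemma decay:
  assumes k: "0 < k" "k < 1"
    and init: "\<And>s \<theta>. s \<in> {1, -1} \<Longrightarrow> (norm (us s (\<tau>0, \<theta>)))\<^sup>2 \<le> A s"
    and A: "(A 1 + A (-1)) / 2 \<le> k\<^sup>2"
  shows "\<exists>t1 \<delta> C. 1 \<le> t1 \<and> 0 < \<delta> \<and> \<delta> \<le> 1 \<and> 0 \<le> C \<and> (\<forall>t\<ge>t1. \<forall>\<theta>. norm (w (t, \<theta>)) \<le> k \<and>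
    exp (- t) * norm (y (t, \<theta>)) \<le> C * exp (- (\<delta> * t)) \<and> norm (W (t, \<theta>)) \<le> C * exp (- (\<delta> * t)))"
proof -
  define D where "D = (A 1 - A (-1)) / 2"
  \<comment> \<open>\<open>\<kappa>\<close> and \<open>k2\<close> cut the gap between
    \<open>k\<close> and 1 into thirds: the null components need room above \<open>k\<close>, the
    growth exponent room above \<open>\<kappa>\<close>.\<close>
  define \<kappa> where "\<kappa> = (2 * k + 1) / 3"
  define k2 where "k2 = (k + 2) / 3"
  have k': "0 < \<kappa>" "k < \<kappa>" "\<kappa> < k2" "0 < k2" "k2 < 1" "\<kappa> \<le> 1"
    using k by (auto simp: \<kappa>_def k2_def)
  have gap: "\<kappa>\<^sup>2 - k\<^sup>2 > 0" using k k' by (simp add: power_strict_mono)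
  \<comment> \<open>From this time on e^(-x) \<le> 1/x brings the imbalance of the two suprema below
    \<open>\<kappa>\<^sup>2 - k\<^sup>2\<close>.\<close>
  define t1 where "t1 = max 1 (\<tau>0 + \<bar>D\<bar> / (\<kappa>\<^sup>2 - k\<^sup>2) + 1)"
  have t1: "1 \<le> t1" by (simp add: t1_def)
  have "0 \<le> \<bar>D\<bar> / (\<kappa>\<^sup>2 - k\<^sup>2)" using gap by simp
  then have t1': "\<tau>0 + 1 \<le> t1" unfolding t1_def by linarith
  have energy: "(norm (us s (t, \<theta>)))\<^sup>2 \<le> k\<^sup>2 + s * (D * exp (\<tau>0 - t))"
    if "s \<in> {1, -1}" "t \<ge> t1" for s t \<theta>
  proof -
    have "(norm (us s (t, \<theta>)))\<^sup>2 \<le> (A 1 + A (-1)) / 2 + s * (D * exp (\<tau>0 - t))"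
      unfolding D_def using that t1' by (intro characteristic_energy_bound init) auto
    then show ?thesis using A by linarith
  qed
  have us: "norm (us s (t, \<theta>)) \<le> \<kappa>" if s: "s \<in> {1, -1}" and t: "t \<ge> t1" for s t \<theta>
  proof (rule power2_le_imp_le)
    have pos: "t - \<tau>0 > 0" using t t1' by simp
    have "s * (D * exp (\<tau>0 - t)) \<le> \<bar>D\<bar> * exp (- (t - \<tau>0))"
      using s by (auto simp: mult_right_mono abs_le_iff)
    also have "\<dots> \<le> \<bar>D\<bar> * (1 / (t - \<tau>0))"
      using pos by (intro mult_left_mono exp_minus_le_inverse) auto
    also have "\<dots> \<le> \<kappa>\<^sup>2 - k\<^sup>2"
    proof -
      have "\<bar>D\<bar> / (\<kappa>\<^sup>2 - k\<^sup>2) \<le> t - \<tau>0" using t by (simp add: t1_def)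
      then show ?thesis using gap pos by (simp add: divide_simps mult.commute)
    qed
    finally show "(norm (us s (t, \<theta>)))\<^sup>2 \<le> \<kappa>\<^sup>2" using energy[OF s t, of \<theta>] by linarith
  qed (use k' in simp)
  \<comment> \<open>Averaging over both signs cancels the terms with \<open>D\<close>, so
    \<open>w\<close> obeys the bound \<open>k\<close> itself; this later yields the sharp bound on
    the limit.\<close>
  have w: "norm (w (t, \<theta>)) \<le> k" if "t \<ge> t1" for t \<theta>
  proof (rule power2_le_imp_le)
    have "(norm (w (t, \<theta>)))\<^sup>2 \<le> ((norm (us 1 (t, \<theta>)))\<^sup>2 + (norm (us (-1) (t, \<theta>)))\<^sup>2) / 2"
      by (rule norm_sq_half_sum_le) (simp add: us_def)
    also have "\<dots> \<le> k\<^sup>2" using energy[of 1 t \<theta>] energy[of "-1" t \<theta>] that by simp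
    finally show "(norm (w (t, \<theta>)))\<^sup>2 \<le> k\<^sup>2" .
  qed (use k in simp)
  have "\<exists>C\<ge>0. \<forall>t\<ge>t1. \<forall>\<theta>. norm (y (t, \<theta>)) \<le> C * exp (k2 * t) \<and>
    (\<forall>s\<in>{1, -1}. norm (Xs s (t, \<theta>)) \<le> \<kappa> * C * exp (k2 * t))"
    by (rule second_order_growth[OF k'(1,3)]) (rule us)
  then obtain C where C: "C \<ge> 0"
    "\<And>t \<theta>. t \<ge> t1 \<Longrightarrow> norm (y (t, \<theta>)) \<le> C * exp (k2 * t)"
    "\<And>s t \<theta>. t \<ge> t1 \<Longrightarrow> s \<in> {1, -1} \<Longrightarrow> norm (Xs s (t, \<theta>)) \<le> \<kappa> * C * exp (k2 * t)"
    by meson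
  have e: "exp (- t) * exp (k2 * t) = exp (- ((1 - k2) * t))" for t
    by (simp add: exp_add[symmetric] algebra_simps)
  have y: "exp (- t) * norm (y (t, \<theta>)) \<le> C * exp (- ((1 - k2) * t))" if "t \<ge> t1" for t \<theta>
    using mult_left_mono[OF C(2)[OF that, of \<theta>], of "exp (- t)"] e[of t] by (simp add: mult.left_commute)
  have W: "norm (W (t, \<theta>)) \<le> C * exp (- ((1 - k2) * t))" if "t \<ge> t1" for t \<theta>
  proof -
    \<comment> \<open>The difference isolates \<open>exp (- t) * Y\<close>, which grows at most like
      e^(k2 t); the second factor e^(-t) in \<open>W\<close> then gives decay.\<close>
    have "2 * (of_real (exp (- t)) * Y (t, \<theta>)) = Xs 1 (t, \<theta>) - Xs (-1) (t, \<theta>)" by (simp add: Xs_def)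
    then have "norm (2 * (of_real (exp (- t)) * Y (t, \<theta>))) \<le> norm (Xs 1 (t, \<theta>)) + norm (Xs (-1) (t, \<theta>))"
      by (simp only: norm_triangle_ineq4)
    then have "exp (- t) * norm (Y (t, \<theta>)) \<le> \<kappa> * C * exp (k2 * t)"
      using C(3)[OF that, of 1 \<theta>] C(3)[OF that, of "-1" \<theta>] by (simp add: norm_mult)
    also have "\<dots> \<le> 1 * C * exp (k2 * t)"
      using k' C(1) by (intro mult_right_mono) auto
    finally have "exp (- t) * (exp (- t) * norm (Y (t, \<theta>))) \<le> exp (- t) * (1 * C * exp (k2 * t))"
      by (rule mult_left_mono) simp
    moreover have "norm (W (t, \<theta>)) = exp (- t) * (exp (- t) * norm (Y (t, \<theta>)))"
      by (simp add: W_eq norm_mult mult.assoc[symmetric] exp_add[symmetric])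
    ultimately show ?thesis using e[of t] by (simp add: mult.left_commute)
  qed
  have "0 < 1 - k2" "1 - k2 \<le> 1" using k' by auto
  then show ?thesis using t1 C(1) w y W by blast
qed

end

theorem theorem2:
  fixes z :: "real \<times> real \<Rightarrow> complex" and \<alpha> \<tau>0 :: real
  assumes smooth: "smooth2 z"
    and periodic: "\<forall>t \<theta>. z (t, \<theta> + 2 * pi) = z (t, \<theta>)"
    and disc: "\<forall>p. norm (z p) < 1"
    and pde: "\<forall>t \<theta>.
      vector_derivative (\<lambda>s. pt z (s, \<theta>) / complex_of_real ((1 - (norm (z (s, \<theta>)))\<^sup>2)\<^sup>2)) (at t)
      - complex_of_real (exp (-2 * t)) *
        vector_derivative (\<lambda>s. pth z (t, s) / complex_of_real ((1 - (norm (z (t, s)))\<^sup>2)\<^sup>2)) (at \<theta>)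
      = 2 * z (t, \<theta>) / complex_of_real ((1 - (norm (z (t, \<theta>)))\<^sup>2) ^ 3)
        * complex_of_real ((norm (pt z (t, \<theta>)))\<^sup>2 - exp (-2 * t) * (norm (pth z (t, \<theta>)))\<^sup>2)"
    and alpha: "0 < \<alpha>" "\<alpha> < 1"
    and init: "(1/2) * (SUP \<theta>\<in>{0..2*pi}.
                   (normD (z (\<tau>0, \<theta>)) (pt z (\<tau>0, \<theta>) + complex_of_real (exp (- \<tau>0)) * pth z (\<tau>0, \<theta>)))\<^sup>2)
             + (1/2) * (SUP \<theta>\<in>{0..2*pi}.
                   (normD (z (\<tau>0, \<theta>)) (pt z (\<tau>0, \<theta>) - complex_of_real (exp (- \<tau>0)) * pth z (\<tau>0, \<theta>)))\<^sup>2)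
             \<le> (1 - \<alpha>)\<^sup>2"
  shows "\<exists>v :: real \<Rightarrow> complex. continuous_on UNIV v \<and> (\<forall>\<theta>. v (\<theta> + 2 * pi) = v \<theta>)
     \<and> (\<forall>\<theta>. norm (v \<theta>) \<le> 1 - \<alpha>)
     \<and> (\<exists>C T. \<forall>t\<ge>T.
          (SUP \<theta>\<in>{0..2*pi}. norm (hypvec (z (t, \<theta>)) / complex_of_real t - v \<theta>))
        + (SUP \<theta>\<in>{0..2*pi}. norm (2 * pt z (t, \<theta>) / complex_of_real (1 - (norm (z (t, \<theta>)))\<^sup>2) - v \<theta>))
        + exp (- t) * (SUP \<theta>\<in>{0..2*pi}. norm (2 * pth z (t, \<theta>) / complex_of_real (1 - (norm (z (t, \<theta>)))\<^sup>2)))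
        \<le> C / t)"
proof -
  interpret periodic_disc_wave_map z
    by unfold_locales (use smooth disc pde periodic in auto)
  define k where "k = 1 - \<alpha>"
  have k: "0 < k" "k < 1" using alpha by (auto simp: k_def)
  define A where "A s = (SUP \<theta>\<in>{0..2*pi}. (norm (us s (\<tau>0, \<theta>)))\<^sup>2)" for s
  have us_plus: "normD (z (\<tau>0, \<theta>)) (pt z (\<tau>0, \<theta>) + complex_of_real (exp (- \<tau>0)) * pth z (\<tau>0, \<theta>))
      = norm (us 1 (\<tau>0, \<theta>))" for \<theta>
    unfolding normD_eq by (simp add: us_def w_def y_def algebra_simps)
  have us_minus: "normD (z (\<tau>0, \<theta>)) (pt z (\<tau>0, \<theta>) - complex_of_real (exp (- \<tau>0)) * pth z (\<tau>0, \<theta>))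
      = norm (us (-1) (\<tau>0, \<theta>))" for \<theta>
    unfolding normD_eq by (simp add: us_def w_def y_def algebra_simps)
  have A: "(A 1 + A (-1)) / 2 \<le> k\<^sup>2"
    using init unfolding us_plus us_minus by (simp add: A_def k_def)
  \<comment> \<open>Periodicity extends the bound by the supremum over one period to all
    angles.\<close>
  have us_init: "(norm (us s (\<tau>0, \<theta>)))\<^sup>2 \<le> A s" for s \<theta>
  proof -
    have "\<exists>N. \<forall>\<theta>. (norm (us s (\<tau>0, \<theta>)))\<^sup>2 \<le> N"
      by (rule periodic_bounded) (auto intro!: continuous_intros simp: us_periodic)
    then obtain N where N: "\<And>\<theta>. (norm (us s (\<tau>0, \<theta>)))\<^sup>2 \<le> N" by blast
    obtain x where x: "x \<in> {0..2*pi}"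
      and "\<And>f :: real \<Rightarrow> complex. (\<forall>\<theta>. f (\<theta> + 2 * pi) = f \<theta>) \<Longrightarrow> f \<theta> = f x"
      using periodic_representative[where 'a = complex] by meson
    from this(2)[of "\<lambda>\<theta>. us s (\<tau>0, \<theta>)"] us_periodic
    have "us s (\<tau>0, \<theta>) = us s (\<tau>0, x)" by simp
    then show ?thesis
      unfolding A_def by (auto intro!: cSUP_upper2[OF _ x] bdd_aboveI2[where M = N] N)
  qed
  obtain t1 \<delta> C where t1: "1 \<le> t1" and \<delta>: "0 < \<delta>" "\<delta> \<le> 1" and "0 \<le> C"
    and w: "\<And>t \<theta>. t \<ge> t1 \<Longrightarrow> norm (w (t, \<theta>)) \<le> k"
    and y: "\<And>t \<theta>. t \<ge> t1 \<Longrightarrow> exp (- t) * norm (y (t, \<theta>)) \<le> C * exp (- (\<delta> * t))"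
    and W: "\<And>t \<theta>. t \<ge> t1 \<Longrightarrow> norm (W (t, \<theta>)) \<le> C * exp (- (\<delta> * t))"
    using decay[OF k us_init A] by metis
  have w1: "norm (w (t, \<theta>)) \<le> 1" if "t \<ge> t1" for t \<theta>
    using w[OF that, of \<theta>] k by linarith
  obtain K where "\<forall>\<theta>. \<exists>v. (\<lambda>n. w (real n, \<theta>)) \<longlonglongrightarrow> v \<and>
    (\<forall>t\<ge>t1. norm (w (t, \<theta>) - v) \<le> K / t \<and> norm (hypvec (z (t, \<theta>)) / of_real t - v) \<le> K / t)"
    using velocity_ode_limit[OF \<delta> \<open>0 \<le> C\<close> t1 w1 W] by blast
  then obtain v where lim: "\<And>\<theta>. (\<lambda>n. w (real n, \<theta>)) \<longlonglongrightarrow> v \<theta>"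
    and wv: "\<And>t \<theta>. t \<ge> t1 \<Longrightarrow> norm (w (t, \<theta>) - v \<theta>) \<le> K / t"
    and hv: "\<And>t \<theta>. t \<ge> t1 \<Longrightarrow> norm (hypvec (z (t, \<theta>)) / of_real t - v \<theta>) \<le> K / t"
    by metis
  have per: "v (\<theta> + 2 * pi) = v \<theta>" for \<theta>
    using LIMSEQ_unique[OF lim[of "\<theta> + 2 * pi"]] lim[of \<theta>] by (simp add: w_periodic)
  have large: "\<forall>\<^sub>F n in sequentially. real n \<ge> t1"
    using eventually_ge_at_top[of "nat \<lceil>t1\<rceil>"] by eventually_elim (simp add: nat_le_iff ceiling_le_iff)
  have "norm (v \<theta>) \<le> k" for \<theta>
  proof (rule tendsto_upperbound[OF tendsto_norm[OF lim[of \<theta>]]])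
    show "\<forall>\<^sub>F n in sequentially. norm (w (real n, \<theta>)) \<le> k"
      using large by eventually_elim (rule w)
  qed simp
  then have vk: "norm (v \<theta>) \<le> 1 - \<alpha>" for \<theta> by (simp add: k_def)
  \<comment> \<open>The rate \<open>K / t\<close> does not depend on the angle, so \<open>v\<close>
    is a uniform limit of continuous functions.\<close>
  have "uniform_limit UNIV (\<lambda>n \<theta>. w (real n, \<theta>)) v sequentially"
  proof (rule uniform_limitI)
    fix e :: real assume "e > 0"
    have "(\<lambda>n. K / real n) \<longlonglongrightarrow> 0" by (rule lim_const_over_n)
    from order_tendstoD(2)[OF this \<open>e > 0\<close>] large
    show "\<forall>\<^sub>F n in sequentially. \<forall>\<theta>\<in>UNIV. dist (w (real n, \<theta>)) (v \<theta>) < e"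
      by eventually_elim (use wv in \<open>auto simp: dist_norm intro: le_less_trans\<close>)
  qed
  then have cont: "continuous_on UNIV v"
    by (rule uniform_limit_theorem[rotated])
      (auto intro!: always_eventually continuous_on_compose2[OF continuous_on_w[of UNIV]] continuous_intros)
  have "(SUP \<theta>\<in>{0..2*pi}. norm (hypvec (z (t, \<theta>)) / complex_of_real t - v \<theta>))
      + (SUP \<theta>\<in>{0..2*pi}. norm (2 * pt z (t, \<theta>) / complex_of_real (1 - (norm (z (t, \<theta>)))\<^sup>2) - v \<theta>))
      + exp (- t) * (SUP \<theta>\<in>{0..2*pi}. norm (2 * pth z (t, \<theta>) / complex_of_real (1 - (norm (z (t, \<theta>)))\<^sup>2)))
      \<le> (2 * K + C / \<delta>) / t" if t: "t \<ge> t1" for t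
  proof -
    have t0: "t > 0" using t t1 by simp
    have w_eq: "2 * pt z p / complex_of_real (1 - (norm (z p))\<^sup>2) = w p"
      and y_eq: "2 * pth z p / complex_of_real (1 - (norm (z p))\<^sup>2) = y p" for p
      by (simp_all add: w_def y_def lam_of_real)
    have "(SUP \<theta>\<in>{0..2*pi}. norm (hypvec (z (t, \<theta>)) / complex_of_real t - v \<theta>)) \<le> K / t"
      by (rule cSUP_least) (auto intro: hv t)
    moreover have "(SUP \<theta>\<in>{0..2*pi}. norm (w (t, \<theta>) - v \<theta>)) \<le> K / t"
      by (rule cSUP_least) (auto intro: wv t)
    moreover have "exp (- t) * (SUP \<theta>\<in>{0..2*pi}. norm (y (t, \<theta>))) \<le> C / \<delta> / t"
    proof -
      \<comment> \<open>Moving the exponential to the right lets the pointwise bound pass to the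
        supremum.\<close>
      have "(SUP \<theta>\<in>{0..2*pi}. norm (y (t, \<theta>))) \<le> exp t * (C * exp (- (\<delta> * t)))"
      proof (rule cSUP_least)
        fix \<theta>
        show "norm (y (t, \<theta>)) \<le> exp t * (C * exp (- (\<delta> * t)))"
          using mult_left_mono[OF y[OF t, of \<theta>], of "exp t"] by (simp add: mult.assoc[symmetric] exp_minus_inverse)
      qed auto
      then have "exp (- t) * (SUP \<theta>\<in>{0..2*pi}. norm (y (t, \<theta>))) \<le> exp (- t) * (exp t * (C * exp (- (\<delta> * t))))"
        by (rule mult_left_mono) simp
      also have "\<dots> = C * exp (- (\<delta> * t))" by (simp add: mult.assoc[symmetric] exp_add[symmetric])
      also have "\<dots> \<le> C * (1 / (\<delta> * t))"
        using \<open>0 \<le> C\<close> \<delta> t0 by (intro mult_left_mono exp_minus_le_inverse) auto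
      finally show ?thesis by simp
    qed
    ultimately show ?thesis
      unfolding w_eq y_eq by (simp add: add_divide_distrib)
  qed
  then show ?thesis using cont per vk by blast
qed

end
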